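(* Let $0<d^-\leqslant d^+$ be real numbers. There exists a positive constant $c=c(d^+,d^-)$, depending only on $d^+$ and $d^-$, such that the following holds. Let $(d_k)_{k\geqslant 1}$ be any sequence of real numbers with $0<d^-\leqslant d_k\leqslant d^+$ for all $k\geqslant 1$, let the positive numbers $p_j$ ($j\geqslant 0$) be defined by $$p(z)=\sum_{j=0}^\infty p_jz^j=\exp\Bigl\{\sum_{k=1}^\infty\frac{d_k}{k}z^k\Bigr\},$$ and let $g(z)=\sum_{n=0}^\infty a_nz^n$ be analytic for $|z|<1$. Put $$S(g;j)=\sum_{k=0}^{j}a_k\,k\,p_{j-k},\qquad \theta=\min\{d^-,1\}.$$ Then for all integers $n\geqslant 1$ $$\left|\frac{1}{p_n}\sum_{k=0}^na_kp_{n-k}-g(e^{-1/n})-\frac{S(g;n)}{np_n}\right|\leqslant c\left(\frac{1}{n^\theta}\sum_{j=1}^n\frac{|S(g;j)|}{p_j}j^{\theta-2}+\frac{1}{p(e^{-1/n})}\sum_{j>n}\frac{|S(g;j)|}{j}e^{-j/n}\right).$$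
   Context: The coefficients $a_n$ are complex numbers. All objects are defined in the claim. *)

theory Defs
  imports "HOL-Complex_Analysis.Complex_Analysis"
begin

(* Only d 1, d 2, ... matter: the constant coefficient is d 0 / 0 = 0, so that the formal
   composition with the exponential series is the intended one. *)
definition log_series :: "(nat \<Rightarrow> real) \<Rightarrow> real fps"
  where "log_series d = Abs_fps (\<lambda>k. d k / real k)"

definition p_coeff :: "(nat \<Rightarrow> real) \<Rightarrow> nat \<Rightarrow> real"
  where "p_coeff d j = fps_nth (fps_exp 1 oo log_series d) j"

definition p_fun :: "(nat \<Rightarrow> real) \<Rightarrow> real \<Rightarrow> real"
  where "p_fun d x = exp (\<Sum>k. d (Suc k) / real (Suc k) * x ^ Suc k)"

definition S_sum :: "(nat \<Rightarrow> real) \<Rightarrow> (nat \<Rightarrow> complex) \<Rightarrow> nat \<Rightarrow> complex"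
  where "S_sum d a j = (\<Sum>k=0..j. a k * of_nat k * of_real (p_coeff d (j - k)))"

(* The formal coefficients are the Taylor coefficients of the analytic function
   exp (d_1 z + d_2 z^2 / 2 + ...) in the open unit disc. *)

lemma p_coeff_0: "p_coeff d 0 = 1"
  by (simp add: p_coeff_def)

lemma p_coeff_Suc:
  "real (Suc n) * p_coeff d (Suc n) = (\<Sum>k=0..n. d (Suc k) * p_coeff d (n - k))"
proof -
  let ?F = "log_series d" and ?P = "fps_exp 1 oo log_series d"
  have "fps_deriv ?P = fps_deriv ?F * ?P"
    by (subst fps_compose_deriv) (simp_all add: log_series_def mult.commute)
  then have "fps_nth (fps_deriv ?P) n = fps_nth (fps_deriv ?F * ?P) n"
    by simp
  then show ?thesis
    by (simp add: fps_mult_nth p_coeff_def log_series_def del: of_nat_Suc)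
qed

lemma p_coeff_pos:
  assumes "\<And>k. k \<ge> 1 \<Longrightarrow> d k > 0"
  shows "p_coeff d j > 0"
proof (induction j rule: less_induct)
  case (less j)
  show ?case
  proof (cases j)
    case 0
    then show ?thesis by (simp add: p_coeff_0)
  next
    case (Suc n)
    have "(\<Sum>k=0..n. d (Suc k) * p_coeff d (n - k)) > 0"
      by (rule sum_pos) (use less Suc assms in auto)
    then have "real (Suc n) * p_coeff d (Suc n) > 0"
      by (simp only: p_coeff_Suc)
    then show ?thesis
      using Suc by (simp add: zero_less_mult_iff del: of_nat_Suc)
  qed
qed

lemma p_coeff_sums_complex:
  fixes z :: complex
  assumes d: "\<And>k. k \<ge> 1 \<Longrightarrow> \<bar>d k\<bar> \<le> D" and z: "norm z < 1"
  shows "(\<lambda>j. of_real (p_coeff d j) * z ^ j) sums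
           exp (\<Sum>k. of_real (d (Suc k) / real (Suc k)) * z ^ Suc k)"
proof -
  define F :: "complex fps" where "F = Abs_fps (\<lambda>k. of_real (d k / real k))"
  have rF: "fps_conv_radius F \<ge> 1"
    unfolding fps_conv_radius_def
  proof (rule conv_radius_geI_ex')
    fix r :: real assume r: "0 < r" "ereal r < 1"
    show "summable (\<lambda>n. fps_nth F n * of_real r ^ n)"
    proof (rule summable_comparison_test')
      show "summable (\<lambda>n. D * r ^ n)" using r by (intro summable_mult summable_geometric) auto
      fix n :: nat assume n: "n \<ge> 1"
      have "\<bar>d n\<bar> / real n \<le> \<bar>d n\<bar> / 1"
        by (rule divide_left_mono) (use n in auto)
      then have "\<bar>d n\<bar> / real n \<le> D" using d[OF n] by linarith
      moreover have "norm (fps_nth F n * of_real r ^ n) = \<bar>d n\<bar> / real n * r ^ n"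
        using r by (simp add: F_def norm_mult norm_divide norm_power)
      ultimately show "norm (fps_nth F n * of_real r ^ n) \<le> D * r ^ n"
        using r mult_right_mono[of "\<bar>d n\<bar> / real n" D "r ^ n"] by simp
    qed
  qed
  define H where "H = (\<lambda>w. exp (eval_fps F w))"
  define G where "G = fps_expansion H 0"
  have inF: "ereal (norm w) < fps_conv_radius F" if "w \<in> ball 0 1" for w
    using that rF less_le_trans[of "ereal (norm w)" 1 "fps_conv_radius F"] by simp
  have holF: "eval_fps F holomorphic_on ball 0 1"
    by (rule holomorphic_on_eval_fps) (use inF in \<open>auto simp: in_eball_iff\<close>)
  have holH: "H holomorphic_on ball 0 1"
    unfolding H_def by (intro holomorphic_intros holF)
  have eb: "eball 0 1 = (ball 0 1 :: complex set)"
    by (auto simp: in_eball_iff)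
  have rG: "fps_conv_radius G \<ge> 1"
    unfolding G_def by (rule conv_radius_fps_expansion) (use holH eb in simp)
  have expH: "H has_fps_expansion G"
    unfolding G_def by (rule has_fps_expansion_fps_expansion[of "ball 0 1"]) (use holH in auto)
  have expF: "eval_fps F has_fps_expansion F"
    by (rule eval_fps_has_fps_expansion) (use inF[of 0] in \<open>simp add: zero_ereal_def\<close>)
  have e1: "deriv H has_fps_expansion fps_deriv G"
    by (rule has_fps_expansion_deriv[OF expH])
  have e2: "(\<lambda>w. deriv (eval_fps F) w * H w) has_fps_expansion fps_deriv F * G"
    by (intro fps_expansion_intros expH expF)
  have ev: "eventually (\<lambda>w. deriv H w = deriv (eval_fps F) w * H w) (nhds 0)"
  proof -
    have "eventually (\<lambda>w::complex. w \<in> ball 0 1) (nhds 0)"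
      by (rule eventually_nhds_in_open) auto
    then show ?thesis
    proof eventually_elim
      case (elim w)
      have "(eval_fps F has_field_derivative deriv (eval_fps F) w) (at w)"
        by (rule holomorphic_derivI[OF holF _ elim]) simp
      then have "(H has_field_derivative H w * deriv (eval_fps F) w) (at w)"
        unfolding H_def by (rule DERIV_fun_exp)
      then show ?case by (simp add: DERIV_imp_deriv mult.commute)
    qed
  qed
  have eq: "fps_deriv G = fps_deriv F * G"
    by (rule fps_expansion_unique_complex[OF _ e2]) (rule has_fps_expansion_cong[THEN iffD1, OF ev refl e1])
  have G: "fps_nth G j = of_real (p_coeff d j)" for j
  proof (induction j rule: less_induct)
    case (less j)
    show ?case
    proof (cases j)
      case 0
      have "eval_fps F 0 = 0" by (simp add: eval_fps_at_0 F_def)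
      then show ?thesis using 0 has_fps_expansion_imp_0_eq_fps_nth_0[OF expH]
        by (simp add: H_def p_coeff_0)
    next
      case (Suc n)
      have "of_nat (Suc n) * fps_nth G (Suc n) = fps_nth (fps_deriv F * G) n"
        by (simp add: eq[symmetric])
      also have "\<dots> = (\<Sum>k=0..n. of_real (d (Suc k)) * fps_nth G (n - k))"
        by (simp add: fps_mult_nth F_def del: of_nat_Suc)
      also have "\<dots> = (\<Sum>k=0..n. of_real (d (Suc k) * p_coeff d (n - k)))"
        using less Suc by (intro sum.cong) auto
      also have "\<dots> = of_real (real (Suc n) * p_coeff d (Suc n))"
        unfolding p_coeff_Suc by simp
      finally show ?thesis using Suc by (simp del: of_nat_Suc)
    qed
  qed
  have "eval_fps G z = H z"
    using eval_fps_expansion'[of H 0 1 z] holH z by (simp add: eb G_def)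
  moreover have "(\<lambda>j. fps_nth G j * z ^ j) sums eval_fps G z"
    by (rule sums_eval_fps)
      (use z rG less_le_trans[of "ereal (norm z)" 1 "fps_conv_radius G"] in simp)
  moreover have "eval_fps F z = (\<Sum>k. of_real (d (Suc k) / real (Suc k)) * z ^ Suc k)"
  proof -
    have "(\<lambda>k. fps_nth F k * z ^ k) sums eval_fps F z"
      by (rule sums_eval_fps) (use z inF in auto)
    then have "(\<lambda>k. fps_nth F (Suc k) * z ^ Suc k) sums eval_fps F z"
      by (subst sums_Suc_iff) (simp add: F_def)
    then show ?thesis by (simp add: F_def sums_iff del: of_nat_Suc)
  qed
  ultimately show ?thesis by (simp add: G H_def)
qed

lemma p_coeff_sums:
  fixes x :: real
  assumes d: "\<And>k. k \<ge> 1 \<Longrightarrow> \<bar>d k\<bar> \<le> D" and x: "\<bar>x\<bar> < 1"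
  shows "(\<lambda>j. p_coeff d j * x ^ j) sums p_fun d x"
proof -
  have sm: "summable (\<lambda>k. d (Suc k) / real (Suc k) * x ^ Suc k)"
  proof (rule summable_comparison_test')
    show "summable (\<lambda>k. D * \<bar>x\<bar> ^ Suc k)"
      using x by (intro summable_mult) (simp add: summable_Suc_iff summable_geometric)
    fix k :: nat assume "k \<ge> 0"
    have "\<bar>d (Suc k)\<bar> / real (Suc k) \<le> \<bar>d (Suc k)\<bar> / 1"
      by (rule divide_left_mono) auto
    then have "\<bar>d (Suc k)\<bar> / real (Suc k) \<le> D" using d[of "Suc k"] by simp
    then have "\<bar>d (Suc k)\<bar> / real (Suc k) * \<bar>x\<bar> ^ Suc k \<le> D * \<bar>x\<bar> ^ Suc k"
      by (rule mult_right_mono) simp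
    then show "norm (d (Suc k) / real (Suc k) * x ^ Suc k) \<le> D * \<bar>x\<bar> ^ Suc k"
      by (simp only: real_norm_def abs_mult abs_divide power_abs abs_of_nat)
  qed
  have "(\<Sum>k. of_real (d (Suc k) / real (Suc k)) * of_real x ^ Suc k) =
        (of_real (\<Sum>k. d (Suc k) / real (Suc k) * x ^ Suc k) :: complex)"
    using suminf_of_real[OF sm, where 'a = complex]
    by (simp only: of_real_mult of_real_power)
  then have "(\<lambda>j. of_real (p_coeff d j * x ^ j) :: complex) sums of_real (p_fun d x)"
    using p_coeff_sums_complex[of d D "of_real x"] d x
    by (simp only: p_fun_def exp_of_real of_real_mult of_real_power norm_of_real)
  then show ?thesis by (simp only: sums_of_real_iff)
qed

(* The infinite series in the estimate converges. *)
lemma S_sum_tail_summable: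
  fixes n :: nat
  assumes d: "\<And>k. k \<ge> 1 \<Longrightarrow> \<bar>d k\<bar> \<le> D"
    and a: "\<And>z. norm z < 1 \<Longrightarrow> summable (\<lambda>k. a k * z ^ k)" and n: "n \<ge> 1"
  shows "(\<lambda>j. norm (S_sum d a j) / real j * exp (- real j / real n)) summable_on {n<..}"
proof -
  define A where "A = Abs_fps a"
  define P :: "complex fps" where "P = Abs_fps (\<lambda>j. of_real (p_coeff d j))"
  define B where "B = fps_X * fps_deriv A * P"
  have "conv_radius (fps_nth A) \<ge> 1"
    by (rule conv_radius_geI_ex') (auto simp: A_def intro!: a)
  then have rA: "fps_conv_radius (fps_deriv A) \<ge> 1"
    using fps_conv_radius_deriv[of A] by (auto simp: fps_conv_radius_def)
  have "conv_radius (fps_nth P) \<ge> 1"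
  proof (rule conv_radius_geI_ex')
    fix r :: real assume r: "0 < r" "ereal r < 1"
    have "(\<lambda>j. of_real (p_coeff d j) * (of_real r :: complex) ^ j) sums
           exp (\<Sum>k. of_real (d (Suc k) / real (Suc k)) * of_real r ^ Suc k)"
      by (rule p_coeff_sums_complex) (use d r in auto)
    then show "summable (\<lambda>j. fps_nth P j * of_real r ^ j)"
      by (auto simp: P_def dest: sums_summable)
  qed
  then have rP: "fps_conv_radius P \<ge> 1" by (simp add: fps_conv_radius_def)
  have "fps_conv_radius (fps_X * fps_deriv A) \<ge> 1"
    using fps_conv_radius_mult[of fps_X "fps_deriv A"] rA by auto
  then have rB: "fps_conv_radius B \<ge> 1"
    unfolding B_def using fps_conv_radius_mult[of "fps_X * fps_deriv A" P] rP
    by (auto simp: min_def split: if_splits)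
  have BS: "fps_nth B j = S_sum d a j" for j
    unfolding B_def fps_mult_nth[of _ P] S_sum_def
  proof (rule sum.cong)
    fix k show "fps_nth (fps_X * fps_deriv A) k * fps_nth P (j - k) = a k * of_nat k * of_real (p_coeff d (j - k))"
      by (cases k) (simp_all add: A_def P_def del: of_nat_Suc)
  qed simp
  define q where "q = exp (- 1 / real n)"
  have q: "0 < q" "q < 1" using n by (auto simp: q_def)
  have "summable (\<lambda>j. norm (fps_nth B j * of_real q ^ j))"
  proof (rule abs_summable_in_conv_radius)
    have "ereal q < 1" using q by simp
    also have "1 \<le> conv_radius (fps_nth B)" using rB by (simp add: fps_conv_radius_def)
    finally show "ereal (norm (of_real q :: complex)) < conv_radius (fps_nth B)" using q by simp
  qed
  then have sm: "summable (\<lambda>j. norm (S_sum d a j) * q ^ j)"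
    using q by (simp add: BS norm_mult norm_power)
  have "summable (\<lambda>j. norm (S_sum d a j) / real j * q ^ j)"
  proof (rule summable_comparison_test'[OF sm])
    fix j :: nat assume j: "j \<ge> 1"
    have "norm (S_sum d a j) / real j \<le> norm (S_sum d a j) / 1"
      by (rule divide_left_mono) (use j in auto)
    then show "norm (norm (S_sum d a j) / real j * q ^ j) \<le> norm (S_sum d a j) * q ^ j"
      using q mult_right_mono[of "norm (S_sum d a j) / real j" "norm (S_sum d a j)" "q ^ j"]
      by (simp add: abs_mult)
  qed
  moreover have "q ^ j = exp (- real j / real n)" for j
    by (simp add: q_def exp_of_nat_mult[symmetric])
  ultimately have "(\<lambda>j. norm (S_sum d a j) / real j * exp (- real j / real n)) summable_on UNIV"
    by (intro norm_summable_imp_summable_on) (simp add: abs_mult)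
  then show ?thesis by (rule summable_on_subset_banach) simp
qed

end

theory Submission
  imports Defs
begin

text \<open>Write \<open>p(z)\<close> for the generating function of the numbers \<open>p j = p_coeff d j\<close>, \<open>r = exp (- 1 / n)\<close>, and
\<open>S j = S_sum d a j\<close>. The series with coefficients \<open>S j\<close> is \<open>z g'(z) p(z)\<close>, so the sequence \<open>S\<close>
determines \<open>g\<close> up to its constant term, and every quantity in the estimate is linear in \<open>S\<close>:
the mean equals \<open>a 0 + \<Sum>j=1..n. S j * b j / p n\<close> and \<open>g(r)\<close> equals \<open>a 0 + \<Sum>j\<ge>1. S j * v j\<close>, where
\<open>b j = \<integral>\<^bsub>0..1\<^esub> u^(j-1) f(n-j,u) du\<close> and \<open>v j = \<integral>\<^bsub>0..r\<^esub> u^(j-1) / p(u) du\<close>, with \<open>f(m,u)\<close> the coefficient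
of \<open>z^m\<close> in \<open>p(z) / p(u z)\<close> (\<open>weighted_mean_expand\<close>, \<open>value_expand\<close>). The subtracted term
\<open>S n / (n p n)\<close> is exactly the contribution of \<open>b n\<close>. Hence it suffices to bound, for each single
index, \<open>b j / p n - v j\<close> when \<open>j < n\<close>, and \<open>v j\<close> when \<open>j \<ge> n\<close>.

For \<open>j \<ge> n / 4\<close> both kernels are small by themselves, because \<open>p(x) / p(y)\<close> is at most a power of
\<open>(1 - y) / (1 - x)\<close>, because \<open>p n\<close> has the order of \<open>p(r) / n\<close>, and because \<open>f(m,u)\<close> vanishes to first
order at \<open>u = 1\<close> (\<open>value_kernel_bound\<close>, \<open>sum_kernel_bound\<close>, \<open>p_coeff_lower\<close>).

For \<open>j \<le> n / 4\<close> the heart of the matter is that \<open>f(n-j,u)\<close> is close to \<open>p n / p(u)\<close>, with relative error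
of order \<open>(n (1 - w))^(-\<theta>)\<close>, where \<open>w = max u (exp (- 1 / j))\<close> (\<open>coeff_quotient_approx\<close>). The
difference of the two is the coefficient of \<open>z^n\<close> in \<open>p(z) (z^j / p(u z) - 1 / p(u))\<close>. The coefficients of
\<open>1 / p\<close> have no fixed sign and may be large, so they are not used directly. Instead one writes this as \<open>F(z) \<psi>(z)\<close> with
\<open>F(z) = p(z) / p(w z)\<close> and \<open>\<psi>(z) = z^j p(w z) / p(u z) - p(w z) / p(u)\<close>: now \<open>\<psi>\<close> is a difference of two
series with nonnegative coefficients and equal sums, concentrated on indices of order \<open>1 / (1 - w)\<close>.
Since all \<open>d k\<close> are at least \<open>\<theta>\<close>, the first factor splits as \<open>F = A G\<close>, where
\<open>A(z) = ((1 - w z) / (1 - z))^\<theta>\<close> and \<open>G\<close> still has nonnegative coefficients. As \<open>\<theta> \<le> 1\<close>, the coefficients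
of \<open>A\<close> decrease from index one on, and summation by parts together with \<open>\<psi>(1) = 0\<close> shows that \<open>A \<psi>\<close> has
coefficients which, in units of \<open>p(w) / p(u)\<close>, are bounded in \<open>l\<^sup>1\<close> and of order \<open>1 / k\<close> for \<open>k \<ge> n / 2\<close>
(\<open>binomial_smoothing\<close>). The factor \<open>G\<close> may be very
irregular, but convolving with it costs only the crude bound \<open>G(r) / n\<close> for its coefficients, and \<open>G(r)\<close> is
smaller than \<open>F(r)\<close> by the factor \<open>((1 - r) / (1 - w r))^\<theta>\<close>. This is the source of the exponent \<open>\<theta>\<close>.
Integrated against \<open>u^(j-1) / p(u)\<close>, the error becomes a multiple of \<open>(j / n)^\<theta> / (j\<^sup>2 p j)\<close>, as required
(\<open>weighted_inverse_p_fun_bound\<close>, \<open>kernel_difference_small_index\<close>).\<close>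

section \<open>Coefficients and values of the exponential of a power series\<close>

lemma p_coeff_unique:
  assumes "x 0 = 1"
    and "\<And>n. real (Suc n) * x (Suc n) = (\<Sum>k=0..n. d (Suc k) * x (n - k))"
  shows "x n = p_coeff d n"
proof (induction n rule: less_induct)
  case (less n)
  show ?case
  proof (cases n)
    case 0
    then show ?thesis using assms(1) by (simp add: p_coeff_0)
  next
    case (Suc m)
    have "(\<Sum>k=0..m. d (Suc k) * x (m - k)) = (\<Sum>k=0..m. d (Suc k) * p_coeff d (m - k))"
      using less Suc by (intro sum.cong) auto
    then have "real (Suc m) * x (Suc m) = real (Suc m) * p_coeff d (Suc m)"
      by (simp only: assms(2) p_coeff_Suc)
    then show ?thesis using Suc by (simp del: of_nat_Suc)
  qed
qed

text \<open>A product of two exponentials satisfies the recursion of the summed weights. In particular \<open>- d\<close> gives the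
coefficients of \<open>1 / p\<close>, \<open>d k * w ^ k\<close> those of \<open>p(w z)\<close>, and \<open>d k * (1 - w ^ k)\<close> those of \<open>p(z) / p(w z)\<close>.\<close>
lemma p_coeff_add:
  "p_coeff (\<lambda>k. d k + e k) n = (\<Sum>i=0..n. p_coeff d i * p_coeff e (n - i))"
proof -
  let ?P = "\<lambda>d. fps_exp (1::real) oo log_series d"
  have deriv: "fps_deriv (?P d) = fps_deriv (log_series d) * ?P d" for d
    by (subst fps_compose_deriv) (simp_all add: log_series_def mult.commute)
  define R where "R = ?P d * ?P e"
  have "fps_deriv R = (fps_deriv (log_series d) + fps_deriv (log_series e)) * R"
    by (simp add: R_def deriv algebra_simps)
  then have rec: "fps_nth (fps_deriv R) m
      = fps_nth ((fps_deriv (log_series d) + fps_deriv (log_series e)) * R) m" for m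
    by simp
  have "fps_nth R n = p_coeff (\<lambda>k. d k + e k) n"
  proof (rule p_coeff_unique)
    show "fps_nth R 0 = 1"
      using p_coeff_0[of d] p_coeff_0[of e] by (simp add: p_coeff_def R_def)
    show "real (Suc m) * fps_nth R (Suc m) =
        (\<Sum>k=0..m. (d (Suc k) + e (Suc k)) * fps_nth R (m - k))" for m
    proof -
      have "fps_nth (fps_deriv (log_series d) + fps_deriv (log_series e)) k
          = d (Suc k) + e (Suc k)" for k
        by (simp add: log_series_def del: of_nat_Suc)
      then show ?thesis
        using rec[of m] by (simp add: fps_mult_nth[of _ R] del: of_nat_Suc)
    qed
  qed
  then show ?thesis by (simp add: R_def fps_mult_nth p_coeff_def)
qed

lemma p_coeff_scale: "p_coeff (\<lambda>k. d k * w ^ k) n = p_coeff d n * w ^ n"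
proof (rule p_coeff_unique[symmetric])
  show "p_coeff d 0 * w ^ 0 = 1" by (simp add: p_coeff_0)
  fix n
  have "real (Suc n) * (p_coeff d (Suc n) * w ^ Suc n)
      = (\<Sum>k=0..n. d (Suc k) * p_coeff d (n - k)) * w ^ Suc n"
    by (simp only: p_coeff_Suc mult.assoc[symmetric])
  also have "\<dots> = (\<Sum>k=0..n. d (Suc k) * w ^ Suc k * (p_coeff d (n - k) * w ^ (n - k)))"
    unfolding sum_distrib_right
  proof (rule sum.cong)
    fix k assume "k \<in> {0..n}"
    then have "w ^ Suc n = w ^ Suc k * w ^ (n - k)"
      by (simp flip: power_add)
    then show "d (Suc k) * p_coeff d (n - k) * w ^ Suc n
        = d (Suc k) * w ^ Suc k * (p_coeff d (n - k) * w ^ (n - k))"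
      by (simp only: mult_ac)
  qed simp
  finally show "real (Suc n) * (p_coeff d (Suc n) * w ^ Suc n)
      = (\<Sum>k=0..n. d (Suc k) * w ^ Suc k * (p_coeff d (n - k) * w ^ (n - k)))" .
qed

lemma p_coeff_nonneg:
  assumes "\<And>k. k \<ge> 1 \<Longrightarrow> d k \<ge> 0"
  shows "p_coeff d j \<ge> 0"
proof (induction j rule: less_induct)
  case (less j)
  show ?case
  proof (cases j)
    case 0
    then show ?thesis by (simp add: p_coeff_0)
  next
    case (Suc n)
    have "(\<Sum>k=0..n. d (Suc k) * p_coeff d (n - k)) \<ge> 0"
      by (rule sum_nonneg) (use less Suc assms in auto)
    then have "real (Suc n) * p_coeff d (Suc n) \<ge> 0"
      by (simp only: p_coeff_Suc)
    then show ?thesis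
      using Suc by (simp add: zero_le_mult_iff del: of_nat_Suc)
  qed
qed

lemma p_coeff_one: "p_coeff (\<lambda>k. 1) n = 1"
  by (rule p_coeff_unique[symmetric]) auto

lemma p_coeff_zero: "p_coeff (\<lambda>k. 0) n = (if n = 0 then 1 else 0)"
  by (rule p_coeff_unique[symmetric]) auto

lemma p_fun_pos: "p_fun d x > 0"
  by (simp add: p_fun_def)

lemma ln_p_fun_sums:
  fixes x :: real
  assumes d: "\<And>k. k \<ge> 1 \<Longrightarrow> \<bar>d k\<bar> \<le> D" and x: "\<bar>x\<bar> < 1"
  shows "(\<lambda>k. d (Suc k) * x ^ Suc k / real (Suc k)) sums ln (p_fun d x)"
proof -
  have "summable (\<lambda>k. d (Suc k) / real (Suc k) * x ^ Suc k)"
  proof (rule summable_comparison_test')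
    show "summable (\<lambda>k. D * \<bar>x\<bar> ^ Suc k)"
      using x by (intro summable_mult) (simp add: summable_Suc_iff summable_geometric)
    fix k :: nat
    have "\<bar>d (Suc k)\<bar> / real (Suc k) \<le> \<bar>d (Suc k)\<bar> / 1"
      by (rule divide_left_mono) auto
    then have "\<bar>d (Suc k)\<bar> / real (Suc k) \<le> D" using d[of "Suc k"] by simp
    then have "\<bar>d (Suc k)\<bar> / real (Suc k) * \<bar>x\<bar> ^ Suc k \<le> D * \<bar>x\<bar> ^ Suc k"
      by (rule mult_right_mono) simp
    then show "norm (d (Suc k) / real (Suc k) * x ^ Suc k) \<le> D * \<bar>x\<bar> ^ Suc k"
      by (simp only: real_norm_def abs_mult abs_divide power_abs abs_of_nat)
  qed
  then show ?thesis
    by (simp add: p_fun_def summable_sums del: of_nat_Suc)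
qed

text \<open>Constant weights give the geometric series, and with it the series of the logarithm.\<close>
lemma p_fun_one:
  fixes x :: real
  assumes "\<bar>x\<bar> < 1"
  shows "p_fun (\<lambda>k. 1) x = 1 / (1 - x)"
proof -
  have "(\<lambda>j. x ^ j) sums p_fun (\<lambda>k. 1) x"
    using p_coeff_sums[of "\<lambda>k. 1" 1 x] assms by (simp add: p_coeff_one)
  moreover have "(\<lambda>j. x ^ j) sums (1 / (1 - x))"
    using assms geometric_sums[of x] by simp
  ultimately show ?thesis by (rule sums_unique2)
qed

text \<open>All comparisons of values of generating functions are instances of this one: an inequality between
the weights, with a multiple of \<open>s ^ k - t ^ k\<close> to spare, is divided by \<open>k\<close> and summed, and the spare
part sums to a logarithm.\<close>
lemma p_fun_compare:
  fixes x y s t :: real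
  assumes d: "\<And>k. k \<ge> 1 \<Longrightarrow> \<bar>d k\<bar> \<le> D" and e: "\<And>k. k \<ge> 1 \<Longrightarrow> \<bar>e k\<bar> \<le> D"
    and "\<bar>x\<bar> < 1" "\<bar>y\<bar> < 1" "\<bar>s\<bar> < 1" "\<bar>t\<bar> < 1"
    and le: "\<And>k. k \<ge> 1 \<Longrightarrow> d k * x ^ k \<le> e k * y ^ k + \<kappa> * (s ^ k - t ^ k)"
  shows "p_fun d x \<le> p_fun e y * ((1 - t) / (1 - s)) powr \<kappa>"
proof -
  have lnone: "(\<lambda>k. x ^ Suc k / real (Suc k)) sums (- ln (1 - x))" if "\<bar>x\<bar> < 1" for x :: real
    using ln_p_fun_sums[of "\<lambda>k. 1" 1 x] that ln_inverse[of "1 - x"]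
    by (simp add: p_fun_one inverse_eq_divide del: of_nat_Suc power_Suc ln_inverse ln_div)
  have upper: "(\<lambda>k. e (Suc k) * y ^ Suc k / real (Suc k)
        + \<kappa> * (s ^ Suc k / real (Suc k) - t ^ Suc k / real (Suc k))) sums
      (ln (p_fun e y) + \<kappa> * (- ln (1 - s) - (- ln (1 - t))))"
    by (intro sums_add sums_mult sums_diff lnone ln_p_fun_sums[of _ D] assms)
  have lower: "(\<lambda>k. d (Suc k) * x ^ Suc k / real (Suc k)) sums ln (p_fun d x)"
    by (intro ln_p_fun_sums[of _ D] assms)
  have "ln (p_fun d x) \<le> ln (p_fun e y) + \<kappa> * (- ln (1 - s) - (- ln (1 - t)))"
  proof (rule sums_le[OF _ lower upper])
    fix k
    have "d (Suc k) * x ^ Suc k / real (Suc k)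
        \<le> (e (Suc k) * y ^ Suc k + \<kappa> * (s ^ Suc k - t ^ Suc k)) / real (Suc k)"
      by (intro divide_right_mono le) auto
    then show "d (Suc k) * x ^ Suc k / real (Suc k) \<le> e (Suc k) * y ^ Suc k / real (Suc k)
        + \<kappa> * (s ^ Suc k / real (Suc k) - t ^ Suc k / real (Suc k))"
      by (simp add: add_divide_distrib diff_divide_distrib right_diff_distrib del: of_nat_Suc power_Suc)
  qed
  also have "\<dots> = ln (p_fun e y) + \<kappa> * ln ((1 - t) / (1 - s))"
    using assms by (subst ln_div) auto
  also have "\<dots> = ln (p_fun e y * ((1 - t) / (1 - s)) powr \<kappa>)"
    using assms p_fun_pos[of e y] by (subst ln_mult) (auto simp: ln_powr)
  finally show ?thesis
    using assms p_fun_pos[of e y] p_fun_pos[of d x] by (subst (asm) ln_le_cancel_iff) (auto simp: zero_less_mult_iff)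
qed

lemma p_fun_add:
  fixes x :: real
  assumes d: "\<And>k. k \<ge> 1 \<Longrightarrow> \<bar>d k\<bar> \<le> D" and e: "\<And>k. k \<ge> 1 \<Longrightarrow> \<bar>e k\<bar> \<le> D" and x: "\<bar>x\<bar> < 1"
  shows "p_fun (\<lambda>k. d k + e k) x = p_fun d x * p_fun e x"
proof -
  have "\<bar>d k + e k\<bar> \<le> 2 * D" if "k \<ge> 1" for k
    using d[OF that] e[OF that] by linarith
  then have "(\<lambda>k. (d (Suc k) + e (Suc k)) * x ^ Suc k / real (Suc k)) sums ln (p_fun (\<lambda>k. d k + e k) x)"
    using ln_p_fun_sums[of "\<lambda>k. d k + e k" "2 * D" x] x by simp
  moreover have "(\<lambda>k. d (Suc k) * x ^ Suc k / real (Suc k) + e (Suc k) * x ^ Suc k / real (Suc k))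
      sums (ln (p_fun d x) + ln (p_fun e x))"
    by (intro sums_add ln_p_fun_sums[of _ D] assms)
  ultimately have "ln (p_fun (\<lambda>k. d k + e k) x) = ln (p_fun d x) + ln (p_fun e x)"
    by (intro sums_unique2) (simp_all add: add_divide_distrib distrib_right)
  also have "\<dots> = ln (p_fun d x * p_fun e x)"
    using p_fun_pos[of d x] p_fun_pos[of e x] by (simp add: ln_mult)
  finally show ?thesis
    using p_fun_pos[of d x] p_fun_pos[of e x] p_fun_pos[of "\<lambda>k. d k + e k" x]
    by (subst (asm) ln_inj_iff) auto
qed

lemma p_fun_scale: "p_fun (\<lambda>k. d k * w ^ k) x = p_fun d (w * x)"
  by (simp add: p_fun_def power_mult_distrib mult_ac)

section \<open>Growth of the generating function and size of its coefficients\<close>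

definition bounded_weights :: "real \<Rightarrow> (nat \<Rightarrow> real) \<Rightarrow> bool"
  where "bounded_weights D e \<longleftrightarrow> (\<forall>k\<ge>1. 0 \<le> e k \<and> e k \<le> D)"

lemma bounded_weightsD:
  assumes "bounded_weights D e" "k \<ge> 1"
  shows "0 \<le> e k" "e k \<le> D" "\<bar>e k\<bar> \<le> D"
  using assms by (auto simp: bounded_weights_def)

lemma bounded_weights_bound_nonneg: "bounded_weights D e \<Longrightarrow> 0 \<le> D"
  using bounded_weightsD(1,2)[of D e 1] by linarith

lemma p_coeff_weights_nonneg: "bounded_weights D e \<Longrightarrow> 0 \<le> p_coeff e n"
  by (rule p_coeff_nonneg) (rule bounded_weightsD)

lemma p_coeff_weights_sums:
  "bounded_weights D e \<Longrightarrow> \<bar>x\<bar> < 1 \<Longrightarrow> (\<lambda>j. p_coeff e j * x ^ j) sums p_fun e x"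
  by (rule p_coeff_sums[of _ D]) (auto dest: bounded_weightsD)

lemma bounded_weights_damped:
  assumes "bounded_weights D e" "0 \<le> v" "v \<le> w" "w \<le> 1"
  shows "bounded_weights D (\<lambda>k. e k * (w ^ k - v ^ k))"
  unfolding bounded_weights_def
proof (intro allI impI conjI)
  fix k :: nat assume k: "k \<ge> 1"
  have "v ^ k \<le> w ^ k" "w ^ k \<le> 1" "0 \<le> v ^ k"
    using assms power_mono[of v w k] power_le_one[of w k] by auto
  then have *: "0 \<le> w ^ k - v ^ k" "w ^ k - v ^ k \<le> 1" by linarith+
  show "0 \<le> e k * (w ^ k - v ^ k)"
    using * bounded_weightsD[OF assms(1) k] by simp
  have "e k * (w ^ k - v ^ k) \<le> D * 1"
    using * bounded_weightsD[OF assms(1) k] bounded_weights_bound_nonneg[OF assms(1)]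
    by (intro mult_mono) auto
  then show "e k * (w ^ k - v ^ k) \<le> D" by simp
qed

lemma bounded_weights_one_minus:
  "bounded_weights D e \<Longrightarrow> 0 \<le> v \<Longrightarrow> v \<le> 1 \<Longrightarrow> bounded_weights D (\<lambda>k. e k * (1 - v ^ k))"
  using bounded_weights_damped[of D e v 1] by simp

lemma p_fun_mono:
  assumes "bounded_weights D e" "0 \<le> x" "x \<le> y" "y < 1"
  shows "p_fun e x \<le> p_fun e y"
proof -
  have "p_fun e x \<le> p_fun e y * ((1 - 0) / (1 - 0)) powr 0"
  proof (rule p_fun_compare[of _ D])
    fix k :: nat assume k: "k \<ge> 1"
    show "e k * x ^ k \<le> e k * y ^ k + 0 * (0 ^ k - 0 ^ k)"
      using bounded_weightsD[OF assms(1) k] assms by (simp add: mult_left_mono power_mono)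
  qed (use assms bounded_weightsD[OF assms(1)] in auto)
  then show ?thesis by simp
qed

lemma p_fun_ge_one:
  assumes "bounded_weights D e" "0 \<le> x" "x < 1"
  shows "1 \<le> p_fun e x"
proof -
  have "p_fun e 0 = 1" by (simp add: p_fun_def)
  then show ?thesis using p_fun_mono[of D e 0 x] assms by simp
qed

lemma p_fun_ratio_upper:
  assumes "bounded_weights (real K) e" "0 \<le> y" "y \<le> x" "x < 1"
  shows "p_fun e x \<le> p_fun e y * ((1 - y) / (1 - x)) ^ K"
proof -
  have "p_fun e x \<le> p_fun e y * ((1 - y) / (1 - x)) powr real K"
  proof (rule p_fun_compare[of _ "real K"])
    fix k :: nat assume k: "k \<ge> 1"
    have "e k * (x ^ k - y ^ k) \<le> K * (x ^ k - y ^ k)"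
      using bounded_weightsD[OF assms(1) k] assms by (intro mult_right_mono) (auto intro: power_mono)
    then show "e k * x ^ k \<le> e k * y ^ k + K * (x ^ k - y ^ k)"
      by (simp add: algebra_simps)
  qed (use assms bounded_weightsD[OF assms(1)] in auto)
  then show ?thesis using assms by (simp add: powr_realpow)
qed

lemma p_fun_ratio_lower:
  assumes e: "bounded_weights D e" and \<theta>: "\<And>k. k \<ge> 1 \<Longrightarrow> \<theta> \<le> e k"
    and "0 \<le> y" "y \<le> x" "x < 1"
  shows "p_fun e y \<le> p_fun e x * ((1 - x) / (1 - y)) powr \<theta>"
proof (rule p_fun_compare[of _ D])
  fix k :: nat assume k: "k \<ge> 1"
  have "\<theta> * (x ^ k - y ^ k) \<le> e k * (x ^ k - y ^ k)"
    using \<theta>[OF k] assms by (intro mult_right_mono) (auto intro: power_mono)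
  then show "e k * y ^ k \<le> e k * x ^ k + \<theta> * (y ^ k - x ^ k)"
    by (simp add: algebra_simps)
qed (use assms bounded_weightsD[OF e] in auto)

text \<open>The series in question is \<open>x p'(x)\<close>, and \<open>x p'(x) / p(x) = \<Sum>k\<ge>1. e k * x ^ k\<close>.\<close>
lemma first_moment:
  assumes e: "bounded_weights D e" and x: "0 \<le> x" "x < 1"
  shows "summable (\<lambda>i. real i * p_coeff e i * x ^ i)"
    and "(\<Sum>i. real i * p_coeff e i * x ^ i) \<le> D * (x / (1 - x)) * p_fun e x"
proof -
  define \<alpha> where "\<alpha> = (\<lambda>k. if k = 0 then 0 else e k * x ^ k)"
  define \<beta> where "\<beta> = (\<lambda>i. p_coeff e i * x ^ i)"
  have D: "(\<lambda>k. D * x ^ Suc k) sums (D * (x / (1 - x)))"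
    using sums_mult[OF geometric_sums[of x], of "D * x"] x by (simp add: mult_ac)
  have nonneg: "0 \<le> \<alpha> k" "\<alpha> (Suc k) \<le> D * x ^ Suc k" "0 \<le> \<beta> k" for k
    using bounded_weightsD[OF e] p_coeff_weights_nonneg[OF e] x
    by (auto simp: \<alpha>_def \<beta>_def intro!: mult_right_mono simp del: power_Suc)
  have sm: "summable (\<lambda>k. \<alpha> (Suc k))"
    by (rule summable_comparison_test'[OF sums_summable[OF D], of 0]) (use nonneg in auto)
  then have \<alpha>: "summable \<alpha>" by (simp add: summable_Suc_iff)
  have "suminf \<alpha> = (\<Sum>k. \<alpha> (Suc k))"
    using suminf_split_head[OF \<alpha>] by (simp add: \<alpha>_def)
  also have "\<dots> \<le> D * (x / (1 - x))"
    unfolding sums_unique[OF D] by (intro suminf_le nonneg sm sums_summable[OF D])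
  finally have sum\<alpha>: "suminf \<alpha> \<le> D * (x / (1 - x))" .
  have \<beta>: "\<beta> sums p_fun e x"
    unfolding \<beta>_def by (rule p_coeff_weights_sums[OF e]) (use x in auto)
  have "(\<Sum>k\<le>i. \<alpha> k * \<beta> (i - k)) = real i * p_coeff e i * x ^ i" for i
  proof (cases i)
    case 0
    then show ?thesis by (simp add: \<alpha>_def)
  next
    case (Suc m)
    have "(\<Sum>k\<le>i. \<alpha> k * \<beta> (i - k)) = (\<Sum>k\<le>m. \<alpha> (Suc k) * \<beta> (m - k))"
      unfolding Suc by (subst sum.atMost_Suc_shift) (simp add: \<alpha>_def)
    also have "\<dots> = (\<Sum>k=0..m. e (Suc k) * p_coeff e (m - k)) * x ^ i"
      unfolding sum_distrib_right
    proof (rule sum.cong)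
      fix k assume "k \<in> {0..m}"
      then have "x ^ i = x ^ Suc k * x ^ (m - k)" using Suc by (simp flip: power_add)
      then show "\<alpha> (Suc k) * \<beta> (m - k) = e (Suc k) * p_coeff e (m - k) * x ^ i"
        by (simp add: \<alpha>_def \<beta>_def)
    qed (simp add: atMost_atLeast0)
    also have "\<dots> = real i * p_coeff e i * x ^ i"
      unfolding Suc by (simp only: p_coeff_Suc)
    finally show ?thesis .
  qed
  then have S: "(\<lambda>i. real i * p_coeff e i * x ^ i) sums (suminf \<alpha> * suminf \<beta>)"
    using Cauchy_product_sums[of \<alpha> \<beta>] \<alpha> \<beta> nonneg by (simp add: sums_iff)
  then show "summable (\<lambda>i. real i * p_coeff e i * x ^ i)" by (rule sums_summable)
  have "(\<Sum>i. real i * p_coeff e i * x ^ i) = suminf \<alpha> * p_fun e x"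
    using S \<beta> by (simp add: sums_iff)
  also have "\<dots> \<le> D * (x / (1 - x)) * p_fun e x"
    using sum\<alpha> p_fun_pos[of e x] by (intro mult_right_mono) auto
  finally show "(\<Sum>i. real i * p_coeff e i * x ^ i) \<le> D * (x / (1 - x)) * p_fun e x" .
qed

text \<open>The radius at which the first \<open>n\<close> coefficients still count fully and the later ones are damped.\<close>
definition rad :: "nat \<Rightarrow> real"
  where "rad n = exp (- 1 / real n)"

lemma rad_pow: "rad n ^ i = exp (- real i / real n)"
  by (simp add: rad_def exp_of_nat_mult[symmetric])

lemma rad_pos: "0 < rad n"
  by (simp add: rad_def)

lemma rad_less_one: "n \<ge> 1 \<Longrightarrow> rad n < 1"
  by (simp add: rad_def)

lemma rad_mono: "1 \<le> m \<Longrightarrow> m \<le> n \<Longrightarrow> rad m \<le> rad n"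
  by (simp add: rad_def field_simps)

lemma one_minus_rad_upper: "1 - rad n \<le> 1 / real n"
  using exp_ge_add_one_self[of "- 1 / real n"] by (simp add: rad_def)

lemma rad_odds: "n \<ge> 1 \<Longrightarrow> rad n / (1 - rad n) \<le> real n"
proof -
  assume n: "n \<ge> 1"
  have "rad n * (1 + 1 / real n) \<le> rad n * exp (1 / real n)"
    by (intro mult_left_mono exp_ge_add_one_self) (simp add: rad_def)
  also have "\<dots> = 1" by (simp add: rad_def exp_add[symmetric])
  finally have "rad n * (1 + 1 / real n) * real n \<le> 1 * real n"
    by (rule mult_right_mono) simp
  moreover have "rad n * (1 + 1 / real n) * real n = rad n * (real n + 1)"
    using n by (simp add: distrib_left distrib_right)
  ultimately have "rad n * (real n + 1) \<le> real n" by simp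
  then show ?thesis using rad_less_one[OF n] by (simp add: field_simps)
qed

lemma one_minus_rad_lower: "n \<ge> 1 \<Longrightarrow> 1 / (2 * real n) \<le> 1 - rad n"
proof -
  assume n: "n \<ge> 1"
  have "rad n \<le> real n * (1 - rad n)"
    using rad_odds[OF n] rad_less_one[OF n] by (simp add: field_simps)
  then have "1 \<le> (real n + 1) * (1 - rad n)" by (simp add: algebra_simps)
  also have "\<dots> \<le> (2 * real n) * (1 - rad n)"
    using n rad_less_one[OF n] by (intro mult_right_mono) auto
  finally show ?thesis using n by (simp add: field_simps)
qed

lemma p_coeff_partial_sum_le:
  assumes e: "bounded_weights D e" and n: "n \<ge> 1"
  shows "(\<Sum>i\<le>n. p_coeff e i) \<le> 3 * p_fun e (rad n)"
proof -
  have "(\<Sum>i\<le>n. p_coeff e i) \<le> (\<Sum>i\<le>n. 3 * (p_coeff e i * rad n ^ i))"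
  proof (rule sum_mono)
    fix i assume "i \<in> {..n}"
    then have "exp (- 1) \<le> rad n ^ i"
      using n by (simp add: rad_pow field_simps)
    then have "3 * exp (- 1 :: real) \<le> 3 * rad n ^ i" by simp
    moreover have "1 \<le> 3 * exp (- 1 :: real)"
      using exp_le by (simp add: exp_minus field_simps)
    ultimately have "1 \<le> 3 * rad n ^ i" by linarith
    then show "p_coeff e i \<le> 3 * (p_coeff e i * rad n ^ i)"
      using mult_left_mono[of 1 "3 * rad n ^ i" "p_coeff e i"] p_coeff_weights_nonneg[OF e]
      by (simp add: mult_ac)
  qed
  also have "\<dots> = 3 * (\<Sum>i\<le>n. p_coeff e i * rad n ^ i)"
    by (simp add: sum_distrib_left)
  also have "(\<Sum>i\<le>n. p_coeff e i * rad n ^ i) \<le> p_fun e (rad n)"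
  proof -
    have S: "(\<lambda>i. p_coeff e i * rad n ^ i) sums p_fun e (rad n)"
      by (rule p_coeff_weights_sums[OF e]) (use rad_pos[of n] rad_less_one[OF n] in auto)
    have "(\<Sum>i\<le>n. p_coeff e i * rad n ^ i) \<le> (\<Sum>i. p_coeff e i * rad n ^ i)"
      using p_coeff_weights_nonneg[OF e] rad_pos[of n]
      by (intro sum_le_suminf sums_summable[OF S]) auto
    then show ?thesis using S by (simp add: sums_iff)
  qed
  finally show ?thesis by simp
qed

text \<open>Only the weights up to \<open>n\<close> enter the recursion; a bound that depends on \<open>n\<close> is used for
\<open>p(z) / p(u z)\<close>, whose weights are small for small indices.\<close>
lemma p_coeff_le_partial_sum:
  assumes nonneg: "\<And>k. k \<ge> 1 \<Longrightarrow> 0 \<le> e k" and D: "\<And>k. 1 \<le> k \<Longrightarrow> k \<le> n \<Longrightarrow> e k \<le> D" and n: "n \<ge> 1"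
  shows "real n * p_coeff e n \<le> D * (\<Sum>i\<le>n. p_coeff e i)"
proof -
  obtain m where m: "n = Suc m" using n by (cases n) auto
  have D0: "0 \<le> D" using nonneg[OF n] D[OF n] by auto
  have "real n * p_coeff e n = (\<Sum>k=0..m. e (Suc k) * p_coeff e (m - k))"
    unfolding m by (rule p_coeff_Suc)
  also have "\<dots> \<le> (\<Sum>k=0..m. D * p_coeff e (m - k))"
    using D m p_coeff_nonneg[OF nonneg] by (intro sum_mono mult_right_mono) auto
  also have "\<dots> = D * (\<Sum>k\<le>m. p_coeff e k)"
    unfolding sum_distrib_left atMost_atLeast0 by (rule sum.reindex_bij_witness[of _ "\<lambda>i. m - i" "\<lambda>i. m - i"]) auto
  also have "\<dots> \<le> D * (\<Sum>i\<le>n. p_coeff e i)"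
    using m p_coeff_nonneg[OF nonneg] D0 by (intro mult_left_mono sum_mono2) auto
  finally show ?thesis .
qed

lemma p_coeff_upper:
  assumes e: "bounded_weights D e" and n: "n \<ge> 1"
  shows "real n * p_coeff e n \<le> 3 * D * p_fun e (rad n)"
proof -
  have "real n * p_coeff e n \<le> D * (\<Sum>i\<le>n. p_coeff e i)"
    by (rule p_coeff_le_partial_sum) (use bounded_weightsD[OF e] n in auto)
  also have "\<dots> \<le> D * (3 * p_fun e (rad n))"
    by (intro mult_left_mono p_coeff_partial_sum_le[OF e n] bounded_weights_bound_nonneg[OF e])
  finally show ?thesis by simp
qed

text \<open>By the recursion \<open>n * p n\<close> is at least \<open>\<theta>\<close> times the sum of the earlier coefficients. That sum is compared
with a value \<open>p(x)\<close> at a radius \<open>x\<close> smaller than \<open>rad n\<close>, chosen for a Chebyshev argument: the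
first moment at \<open>x\<close> is at most \<open>n / 2\<close> times \<open>p(x)\<close>. Moving from \<open>x\<close> to \<open>rad n\<close> costs a constant factor.\<close>
lemma p_coeff_lower:
  assumes d: "bounded_weights (real K) d" and \<theta>: "\<And>k. k \<ge> 1 \<Longrightarrow> \<theta> \<le> d k" "\<theta> > 0"
    and K: "K \<ge> 1" and n: "n \<ge> 1"
  shows "p_fun d (rad n) \<le> 2 * (2 * real K) ^ K / \<theta> * (real n * p_coeff d n)"
proof -
  define x where "x = rad n ^ (2 * K)"
  have x: "0 < x" "x < 1"
    using rad_pos[of n] rad_less_one[OF n] K by (auto simp: x_def power_Suc_less_one intro: power_less_one_iff[THEN iffD2])
  have xr: "x \<le> rad n"
    using rad_pos[of n] rad_less_one[OF n] K power_decreasing[of 1 "2 * K" "rad n"] by (simp add: x_def)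
  have odds: "x / (1 - x) \<le> real n / (2 * real K)"
  proof -
    have "x * (1 + 2 * real K / real n) \<le> x * exp (2 * real K / real n)"
      using x by (intro mult_left_mono exp_ge_add_one_self) auto
    also have "\<dots> = 1" by (simp add: x_def rad_pow exp_add[symmetric])
    finally have "x * (2 * real K / real n) \<le> 1 - x" by (simp add: algebra_simps)
    then show ?thesis using x n K by (simp add: field_simps)
  qed
  have S: "(\<lambda>i. p_coeff d i * x ^ i) sums p_fun d x"
    by (rule p_coeff_weights_sums[OF d]) (use x in auto)
  note M = first_moment[OF d less_imp_le[OF x(1)] x(2)]
  have nonneg: "0 \<le> p_coeff d i * x ^ i" for i
    using p_coeff_weights_nonneg[OF d] x by auto
  \<comment> \<open>By the choice of the radius the indices from n on carry at most half of the mass.\<close>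
  have "real n * p_fun d x = real n * (\<Sum>i<n. p_coeff d i * x ^ i)
      + real n * (\<Sum>i. p_coeff d (i + n) * x ^ (i + n))"
    unfolding distrib_left[symmetric] sums_unique[OF S]
    by (simp add: suminf_split_initial_segment[OF sums_summable[OF S], of n])
  also have "real n * (\<Sum>i. p_coeff d (i + n) * x ^ (i + n)) \<le> (\<Sum>i. real i * p_coeff d i * x ^ i)"
  proof -
    have "real n * (\<Sum>i. p_coeff d (i + n) * x ^ (i + n))
        = (\<Sum>i. real n * (p_coeff d (i + n) * x ^ (i + n)))"
      by (rule suminf_mult[symmetric]) (rule summable_ignore_initial_segment[OF sums_summable[OF S]])
    also have "\<dots> \<le> (\<Sum>i. real (i + n) * p_coeff d (i + n) * x ^ (i + n))"
    proof (rule suminf_le)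
      show "real n * (p_coeff d (i + n) * x ^ (i + n)) \<le> real (i + n) * p_coeff d (i + n) * x ^ (i + n)" for i
        using nonneg[of "i + n"] mult_right_mono[of "real n" "real (i + n)" "p_coeff d (i + n) * x ^ (i + n)"]
        by (simp add: mult_ac)
      show "summable (\<lambda>i. real n * (p_coeff d (i + n) * x ^ (i + n)))"
        by (intro summable_mult summable_ignore_initial_segment[OF sums_summable[OF S]])
      show "summable (\<lambda>i. real (i + n) * p_coeff d (i + n) * x ^ (i + n))"
        using M(1) by (rule summable_ignore_initial_segment)
    qed
    also have "\<dots> \<le> (\<Sum>i. real i * p_coeff d i * x ^ i)"
    proof -
      have "0 \<le> (\<Sum>i<n. real i * p_coeff d i * x ^ i)"
        using p_coeff_weights_nonneg[OF d] x by (intro sum_nonneg) auto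
      then show ?thesis using suminf_split_initial_segment[OF M(1), of n] by linarith
    qed
    finally show ?thesis .
  qed
  also have "(\<Sum>i. real i * p_coeff d i * x ^ i) \<le> K * (x / (1 - x)) * p_fun d x" by (rule M(2))
  also have "\<dots> \<le> K * (real n / (2 * real K)) * p_fun d x"
    using odds p_fun_pos[of d x] by (intro mult_right_mono mult_left_mono) auto
  also have "\<dots> = real n * (p_fun d x / 2)" using K by simp
  finally have "real n * p_fun d x
      \<le> real n * (\<Sum>i<n. p_coeff d i * x ^ i) + real n * (p_fun d x / 2)"
    by simp
  then have "real n * p_fun d x \<le> real n * (2 * (\<Sum>i<n. p_coeff d i * x ^ i))"
    by linarith
  then have "p_fun d x \<le> 2 * (\<Sum>i<n. p_coeff d i * x ^ i)"
    using n by (simp del: times_divide_eq_right)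
  also have "\<dots> \<le> 2 * (\<Sum>i<n. p_coeff d i)"
    using p_coeff_weights_nonneg[OF d] x by (intro mult_left_mono sum_mono) (auto intro!: mult_left_le power_le_one)
  finally have half: "p_fun d x \<le> 2 * (\<Sum>i<n. p_coeff d i)" .
  have "\<theta> * (\<Sum>i<n. p_coeff d i) \<le> real n * p_coeff d n"
  proof -
    obtain m where m: "n = Suc m" using n by (cases n) auto
    have "\<theta> * (\<Sum>i<n. p_coeff d i) = (\<Sum>k=0..m. \<theta> * p_coeff d (m - k))"
      unfolding m lessThan_Suc_atMost sum_distrib_left atMost_atLeast0
      by (rule sum.reindex_bij_witness[of _ "\<lambda>i. m - i" "\<lambda>i. m - i"]) auto
    also have "\<dots> \<le> (\<Sum>k=0..m. d (Suc k) * p_coeff d (m - k))"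
      using \<theta> p_coeff_weights_nonneg[OF d] by (intro sum_mono mult_right_mono) auto
    also have "\<dots> = real n * p_coeff d n" unfolding m by (rule p_coeff_Suc[symmetric])
    finally show ?thesis .
  qed
  then have low: "(\<Sum>i<n. p_coeff d i) \<le> real n * p_coeff d n / \<theta>"
    using \<theta>(2) by (simp add: field_simps)
  have "p_fun d (rad n) \<le> p_fun d x * ((1 - x) / (1 - rad n)) ^ K"
    by (rule p_fun_ratio_upper[OF d]) (use x xr rad_less_one[OF n] in auto)
  also have "\<dots> \<le> p_fun d x * (2 * real K) ^ K"
  proof (intro mult_left_mono power_mono)
    have "1 + real (2 * K) * (rad n - 1) \<le> (1 + (rad n - 1)) ^ (2 * K)"
      by (rule Bernoulli_inequality) (use rad_pos[of n] in auto)
    then have "1 - x \<le> (2 * real K) * (1 - rad n)" by (simp add: x_def algebra_simps)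
    then show "(1 - x) / (1 - rad n) \<le> 2 * real K"
      using rad_less_one[OF n] by (simp add: field_simps)
  qed (use x rad_less_one[OF n] p_fun_pos[of d x] in auto)
  also have "\<dots> \<le> (2 * (real n * p_coeff d n / \<theta>)) * (2 * real K) ^ K"
    using half low by (intro mult_right_mono) auto
  also have "\<dots> = 2 * (2 * real K) ^ K / \<theta> * (real n * p_coeff d n)" by simp
  finally show ?thesis .
qed

text \<open>The coefficients of \<open>p(z) / p(u z)\<close> vanish at \<open>u = 1\<close>, because each weight \<open>d k * (1 - u ^ k)\<close> does, to
first order.\<close>
lemma p_coeff_one_minus_upper:
  assumes d: "bounded_weights (real K) d" and u: "0 \<le> u" "u \<le> 1" and m: "m \<ge> 1"
  shows "p_coeff (\<lambda>k. d k * (1 - u ^ k)) m \<le> 3 * real K * (1 - u) * (1 + real m * (1 - u)) ^ K"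
proof -
  let ?f = "\<lambda>k. d k * (1 - u ^ k)"
  have f: "bounded_weights K ?f"
    by (rule bounded_weights_one_minus[OF d u])
  have ur: "u * rad m \<le> rad m" using u rad_pos[of m] by (simp add: mult_left_le_one_le)
  have "p_fun ?f (rad m) \<le> p_fun (\<lambda>k. 0) 0 * ((1 - u * rad m) / (1 - rad m)) powr real K"
  proof (rule p_fun_compare[of _ "real K"])
    fix k :: nat assume k: "k \<ge> 1"
    have "?f k * rad m ^ k \<le> K * (1 - u ^ k) * rad m ^ k"
      using bounded_weightsD[OF d k] u rad_pos[of m] by (intro mult_right_mono) (auto simp: power_le_one)
    then show "?f k * rad m ^ k \<le> 0 * 0 ^ k + K * (rad m ^ k - (u * rad m) ^ k)"
      by (simp add: algebra_simps power_mult_distrib)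
    show "\<bar>?f k\<bar> \<le> K" using bounded_weightsD[OF f k] by simp
  next
    show "\<bar>u * rad m\<bar> < 1"
      using le_less_trans[OF ur rad_less_one[OF m]] u rad_pos[of m] by (simp add: abs_mult)
  qed (use rad_pos[of m] rad_less_one[OF m] in auto)
  also have "\<dots> = ((1 - u * rad m) / (1 - rad m)) ^ K"
  proof -
    have "0 < (1 - u * rad m) / (1 - rad m)" using ur rad_less_one[OF m] by simp
    then show ?thesis by (simp add: powr_realpow p_fun_def)
  qed
  also have "\<dots> \<le> (1 + real m * (1 - u)) ^ K"
  proof (rule power_mono)
    have "(1 - u * rad m) / (1 - rad m) = 1 + rad m / (1 - rad m) * (1 - u)"
      using rad_less_one[OF m] by (simp add: field_simps)
    also have "\<dots> \<le> 1 + real m * (1 - u)"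
      using u by (intro add_left_mono mult_right_mono rad_odds[OF m]) auto
    finally show "(1 - u * rad m) / (1 - rad m) \<le> 1 + real m * (1 - u)" .
    show "0 \<le> (1 - u * rad m) / (1 - rad m)" using ur rad_less_one[OF m] by simp
  qed
  finally have pf: "p_fun ?f (rad m) \<le> (1 + real m * (1 - u)) ^ K" .
  have "real m * p_coeff ?f m \<le> (K * (real m * (1 - u))) * (\<Sum>i\<le>m. p_coeff ?f i)"
  proof (rule p_coeff_le_partial_sum)
    fix k assume k: "1 \<le> k" "k \<le> m"
    have "1 + real k * (u - 1) \<le> (1 + (u - 1)) ^ k"
      by (rule Bernoulli_inequality) (use u in auto)
    then have "1 - u ^ k \<le> real k * (1 - u)" by (simp add: algebra_simps)
    also have "\<dots> \<le> real m * (1 - u)" using k u by (intro mult_right_mono) auto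
    finally show "?f k \<le> K * (real m * (1 - u))"
      using bounded_weightsD[OF d k(1)] u by (intro mult_mono) (auto simp: power_le_one)
  qed (use bounded_weightsD[OF f] m in auto)
  then have "p_coeff ?f m \<le> K * (1 - u) * (\<Sum>i\<le>m. p_coeff ?f i)"
    using m by (simp add: mult_ac)
  also have "\<dots> \<le> K * (1 - u) * (3 * p_fun ?f (rad m))"
    using u by (intro mult_left_mono p_coeff_partial_sum_le[OF f m]) auto
  also have "\<dots> \<le> K * (1 - u) * (3 * (1 + real m * (1 - u)) ^ K)"
    using u pf by (intro mult_left_mono) auto
  finally show ?thesis by (simp only: mult_ac)
qed

section \<open>Smoothing by a binomial series\<close>

text \<open>The weights \<open>\<theta> * (1 - w ^ k)\<close> belong to \<open>A(z) = ((1 - w z) / (1 - z))^\<theta>\<close>. Differencing their recursion once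
leaves the geometric kernel \<open>w ^ (k - l)\<close>.\<close>

lemma binomial_weights_step:
  "real (Suc k) * p_coeff (\<lambda>k. \<theta> * (1 - w ^ k)) (Suc k)
    = real k * p_coeff (\<lambda>k. \<theta> * (1 - w ^ k)) k
      + \<theta> * (1 - w) * (\<Sum>l=0..k. w ^ (k - l) * p_coeff (\<lambda>k. \<theta> * (1 - w ^ k)) l)"
proof -
  let ?A = "p_coeff (\<lambda>k. \<theta> * (1 - w ^ k))"
  have rev: "real (Suc k) * ?A (Suc k) = (\<Sum>l=0..k. \<theta> * (1 - w ^ Suc (k - l)) * ?A l)" for k
    unfolding p_coeff_Suc
    by (rule sum.reindex_bij_witness[of _ "\<lambda>i. k - i" "\<lambda>i. k - i"]) auto
  have low: "real k * ?A k = (\<Sum>l=0..k. \<theta> * (1 - w ^ (k - l)) * ?A l)"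
  proof (cases k)
    case (Suc m)
    have "(\<Sum>l=0..m. \<theta> * (1 - w ^ Suc (m - l)) * ?A l) = (\<Sum>l=0..m. \<theta> * (1 - w ^ (Suc m - l)) * ?A l)"
      by (intro sum.cong) (auto simp: Suc_diff_le)
    then show ?thesis using rev[of m] by (simp add: Suc del: of_nat_Suc)
  qed simp
  show ?thesis
    unfolding rev low sum_distrib_left sum.distrib[symmetric]
    by (intro sum.cong) (auto simp: algebra_simps)
qed

text \<open>Let \<open>y k\<close> be the increment of \<open>k * A k\<close>. It satisfies \<open>y (k + 1) = w * y k + \<theta> * (1 - w) * A (k + 1)\<close>,
and \<open>w + \<theta> * (1 - w) \<le> 1\<close> because \<open>\<theta> \<le> 1\<close>; so \<open>y k \<le> A k\<close> propagates, and this inequality is the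
monotonicity of \<open>A\<close>. The second claim bounds \<open>A k - y k\<close> by \<open>A 1 = \<theta> * (1 - w)\<close>; index zero
is excluded since the gap between \<open>A 0 = 1\<close> and \<open>A 1\<close> does not become small with \<open>1 - w\<close>.\<close>
lemma
  assumes \<theta>: "0 \<le> \<theta>" "\<theta> \<le> 1" and w: "0 \<le> w" "w \<le> 1" and k: "k \<ge> 1"
  defines "A \<equiv> p_coeff (\<lambda>k. \<theta> * (1 - w ^ k))"
  shows binomial_weights_antimono: "A (Suc k) \<le> A k"
    and binomial_weights_increment: "real (Suc k) * (A k - A (Suc k)) \<le> 1 - w"
proof -
  define y where "y = (\<lambda>k. \<theta> * (1 - w) * (\<Sum>l=0..k. w ^ (k - l) * A l))"
  have step: "real (Suc k) * A (Suc k) = real k * A k + y k" for k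
    unfolding A_def y_def by (rule binomial_weights_step)
  have y_Suc: "y (Suc k) = w * y k + \<theta> * (1 - w) * A (Suc k)" for k
  proof -
    have "(\<Sum>l=0..k. w ^ (Suc k - l) * A l) = w * (\<Sum>l=0..k. w ^ (k - l) * A l)"
      unfolding sum_distrib_left by (intro sum.cong) (auto simp: Suc_diff_le)
    then show ?thesis by (simp add: y_def algebra_simps)
  qed
  have A_nonneg: "0 \<le> A k" for k
    unfolding A_def using \<theta> w by (intro p_coeff_nonneg) (simp add: power_le_one)
  have y_nonneg: "0 \<le> y k" for k
    unfolding y_def using \<theta> w A_nonneg by (intro mult_nonneg_nonneg sum_nonneg) auto
  have damp: "w * a + \<theta> * (1 - w) * b \<le> b" if "a \<le> b" "0 \<le> b" for a b :: real
  proof -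
    have "w * a + \<theta> * (1 - w) * b \<le> w * b + 1 * (1 - w) * b"
      using \<theta> w that by (intro add_mono mult_left_mono mult_right_mono) auto
    then show ?thesis by (simp add: algebra_simps)
  qed
  have y0: "y 0 = \<theta> * (1 - w)" and A1: "A 1 = \<theta> * (1 - w)"
    using step[of 0] by (simp_all add: y_def A_def p_coeff_0)
  have y_le: "y k \<le> A k" if "k \<ge> 1" for k
    using that
  proof (induction k rule: dec_induct)
    case base
    show ?case using y_Suc[of 0] y0 A1 A_nonneg[of 1] damp[of "y 0" "A 1"] by simp
  next
    case (step n)
    have "real (Suc n) * y n \<le> real (Suc n) * A (Suc n)"
      using mult_left_mono[OF step.IH, of "real n"] \<open>\<And>k. real (Suc k) * A (Suc k) = real k * A k + y k\<close>[of n]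
      by (simp add: algebra_simps)
    then have "y n \<le> A (Suc n)" by (simp del: of_nat_Suc)
    then show ?case unfolding y_Suc by (intro damp A_nonneg)
  qed
  have antimono: "A (Suc k) \<le> A k" if "k \<ge> 1" for k
  proof -
    have "real (Suc k) * A (Suc k) \<le> real (Suc k) * A k"
      using step[of k] y_le[OF that] by (simp add: algebra_simps)
    then show ?thesis by (simp del: of_nat_Suc)
  qed
  show "A (Suc k) \<le> A k" by (rule antimono[OF k])
  have "A k \<le> A 1"
    using k by (induction k rule: dec_induct) (auto intro: order_trans[OF antimono])
  also have "A 1 \<le> 1 - w" unfolding A1 using \<theta> w by (simp add: mult_left_le_one_le)
  finally show "real (Suc k) * (A k - A (Suc k)) \<le> 1 - w"
    using step[of k] y_nonneg[of k] by (simp add: algebra_simps)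
qed

text \<open>As the whole series sums to zero, a partial sum is minus a tail. In the sum of all tails the term
\<open>\<psi> l\<close> occurs \<open>l\<close> times, which produces the first moment.\<close>
lemma partial_sums_of_null_series:
  fixes \<psi> :: "nat \<Rightarrow> real"
  assumes sums: "\<psi> sums 0" and M: "\<And>L. (\<Sum>l\<le>L. real l * \<bar>\<psi> l\<bar>) \<le> M"
  shows "(\<Sum>i<N. \<bar>\<Sum>l\<le>i. \<psi> l\<bar>) \<le> M"
    and "real (Suc i) * \<bar>\<Sum>l\<le>i. \<psi> l\<bar> \<le> M"
proof -
  define \<Psi> where "\<Psi> = (\<lambda>i. \<Sum>l\<le>i. \<psi> l)"
  have lim: "(\<lambda>L. \<bar>\<Psi> L\<bar>) \<longlonglongrightarrow> 0"
    using sums unfolding sums_def_le \<Psi>_def by (simp add: tendsto_rabs_zero)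
  have tail: "\<bar>\<Psi> i\<bar> \<le> (\<Sum>l\<le>L. if i < l then \<bar>\<psi> l\<bar> else 0) + \<bar>\<Psi> L\<bar>" if "i \<le> L" for i L
  proof -
    have "{..L} = {..i} \<union> {i<..L}" "{..L} \<inter> {l. i < l} = {i<..L}" using that by auto
    then have "\<Psi> L = \<Psi> i + (\<Sum>l\<in>{i<..L}. \<psi> l)"
      and "(\<Sum>l\<le>L. if i < l then \<bar>\<psi> l\<bar> else 0) = (\<Sum>l\<in>{i<..L}. \<bar>\<psi> l\<bar>)"
      by (auto simp: \<Psi>_def sum.If_cases intro!: sum.union_disjoint)
    then show ?thesis using sum_abs[of \<psi> "{i<..L}"] by linarith
  qed
  have limM: "a \<le> M" if "\<And>L. L \<ge> L0 \<Longrightarrow> a \<le> M + c * \<bar>\<Psi> L\<bar>" for a c :: real and L0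
  proof (rule LIMSEQ_le_const)
    show "(\<lambda>L. M + c * \<bar>\<Psi> L\<bar>) \<longlonglongrightarrow> M"
      using tendsto_add[OF tendsto_const tendsto_mult_right_zero[OF lim, of c], of M] by simp
  qed (use that in blast)
  have "(\<Sum>i<N. \<bar>\<Psi> i\<bar>) \<le> M"
  proof (rule limM[of N _ "real N"])
    fix L assume L: "L \<ge> N"
    have "(\<Sum>i<N. \<bar>\<Psi> i\<bar>) \<le> (\<Sum>i<N. (\<Sum>l\<le>L. if i < l then \<bar>\<psi> l\<bar> else 0) + \<bar>\<Psi> L\<bar>)"
      using L by (intro sum_mono tail) auto
    also have "\<dots> = (\<Sum>l\<le>L. \<Sum>i<N. if i < l then \<bar>\<psi> l\<bar> else 0) + real N * \<bar>\<Psi> L\<bar>"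
      by (simp add: sum.distrib sum.swap[of _ "{..<N}"])
    also have "(\<Sum>l\<le>L. \<Sum>i<N. if i < l then \<bar>\<psi> l\<bar> else 0) \<le> (\<Sum>l\<le>L. real l * \<bar>\<psi> l\<bar>)"
    proof (rule sum_mono)
      fix l
      have "(\<Sum>i<N. if i < l then \<bar>\<psi> l\<bar> else 0) = real (card ({..<N} \<inter> {i. i < l})) * \<bar>\<psi> l\<bar>"
        by (simp add: sum.If_cases)
      also have "\<dots> \<le> real (card {..<l}) * \<bar>\<psi> l\<bar>"
        by (intro mult_right_mono of_nat_mono card_mono) auto
      finally show "(\<Sum>i<N. if i < l then \<bar>\<psi> l\<bar> else 0) \<le> real l * \<bar>\<psi> l\<bar>" by simp
    qed
    also have "\<dots> \<le> M" by (rule M)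
    finally show "(\<Sum>i<N. \<bar>\<Psi> i\<bar>) \<le> M + real N * \<bar>\<Psi> L\<bar>" by simp
  qed
  then show "(\<Sum>i<N. \<bar>\<Sum>l\<le>i. \<psi> l\<bar>) \<le> M" by (simp add: \<Psi>_def)
  have "real (Suc i) * \<bar>\<Psi> i\<bar> \<le> M"
  proof (rule limM[of i _ "real (Suc i)"])
    fix L assume L: "L \<ge> i"
    have "real (Suc i) * \<bar>\<Psi> i\<bar>
        \<le> real (Suc i) * ((\<Sum>l\<le>L. if i < l then \<bar>\<psi> l\<bar> else 0) + \<bar>\<Psi> L\<bar>)"
      by (intro mult_left_mono tail L) auto
    also have "\<dots> = (\<Sum>l\<le>L. real (Suc i) * (if i < l then \<bar>\<psi> l\<bar> else 0)) + real (Suc i) * \<bar>\<Psi> L\<bar>"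
      by (simp only: distrib_left sum_distrib_left)
    also have "(\<Sum>l\<le>L. real (Suc i) * (if i < l then \<bar>\<psi> l\<bar> else 0)) \<le> (\<Sum>l\<le>L. real l * \<bar>\<psi> l\<bar>)"
      by (intro sum_mono) (auto intro: mult_right_mono)
    also have "\<dots> \<le> M" by (rule M)
    finally show "real (Suc i) * \<bar>\<Psi> i\<bar> \<le> M + real (Suc i) * \<bar>\<Psi> L\<bar>" by simp
  qed
  then show "real (Suc i) * \<bar>\<Sum>l\<le>i. \<psi> l\<bar> \<le> M" by (simp add: \<Psi>_def)
qed

lemma convolution_sum_le:
  fixes f g :: "nat \<Rightarrow> real"
  assumes "\<And>i. 0 \<le> f i" "\<And>i. 0 \<le> g i"
  shows "(\<Sum>k\<le>N. \<Sum>i\<le>k. f i * g (k - i)) \<le> (\<Sum>i\<le>N. f i) * (\<Sum>i\<le>N. g i)"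
proof -
  have "(\<Sum>k\<le>N. \<Sum>i\<le>k. f i * g (k - i)) = (\<Sum>(i, j)\<in>{(i, j). i + j \<le> N}. f i * g j)"
    by (rule sum.triangle_reindex_eq[symmetric])
  also have "\<dots> \<le> (\<Sum>(i, j)\<in>{..N} \<times> {..N}. f i * g j)"
    using assms by (intro sum_mono2) auto
  also have "\<dots> = (\<Sum>i\<le>N. f i) * (\<Sum>i\<le>N. g i)"
    by (simp add: sum_product sum.cartesian_product)
  finally show ?thesis .
qed

lemma summation_by_parts:
  fixes a \<psi> :: "nat \<Rightarrow> real"
  shows "(\<Sum>i<m. a (k - i) * \<psi> i)
    = (\<Sum>i<m. (a (k - i) - a (k - Suc i)) * (\<Sum>l\<le>i. \<psi> l)) + a (k - m) * (\<Sum>l<m. \<psi> l)"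
  by (induction m) (auto simp: algebra_simps lessThan_Suc_atMost[symmetric])

text \<open>The term \<open>A 0 = 1\<close> reproduces \<open>\<psi>\<close> itself. On the rest, summation by parts moves the differences onto \<open>A\<close>
and the partial sums onto \<open>\<psi>\<close>. The differences of a sequence that jumps from 0 to \<open>A 1\<close> and decreases
afterwards have total variation at most \<open>2 * A 1 \<le> 2 * (1 - w)\<close>, which in the application just balances
the first moment \<open>M\<close>, of order \<open>1 / (1 - w)\<close>.\<close>
lemma binomial_smoothing:
  fixes \<psi> :: "nat \<Rightarrow> real"
  assumes \<theta>: "0 \<le> \<theta>" "\<theta> \<le> 1" and w: "0 \<le> w" "w \<le> 1"
    and sums: "\<psi> sums 0"
    and M: "\<And>L. (\<Sum>l\<le>L. real l * \<bar>\<psi> l\<bar>) \<le> M"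
    and B: "\<And>L. (\<Sum>l\<le>L. \<bar>\<psi> l\<bar>) \<le> B"
  defines "A \<equiv> p_coeff (\<lambda>k. \<theta> * (1 - w ^ k))"
  defines "h \<equiv> \<lambda>k. \<Sum>i=0..k. \<psi> i * A (k - i)"
  shows "(\<Sum>k\<le>N. \<bar>h k\<bar>) \<le> B + 2 * (1 - w) * M"
    and "real k * \<bar>h k\<bar> \<le> real k * \<bar>\<psi> k\<bar> + 3 * (1 - w) * M"
proof -
  define a where "a = (\<lambda>m. if m = 0 then 0 else A m)"
  define \<delta> where "\<delta> = (\<lambda>m. \<bar>a m - a (m - 1)\<bar>)"
  define \<Psi> where "\<Psi> = (\<lambda>i. \<Sum>l\<le>i. \<psi> l)"
  have A1: "A 1 = \<theta> * (1 - w)"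
    using p_coeff_Suc[of 0 "\<lambda>k. \<theta> * (1 - w ^ k)"] by (simp add: A_def p_coeff_0)
  have A1_le: "0 \<le> A 1" "A 1 \<le> 1 - w"
    unfolding A1 using \<theta> w by (simp_all add: mult_left_le_one_le)
  have A_nonneg: "0 \<le> A k" for k
    unfolding A_def using \<theta> w by (intro p_coeff_nonneg) (simp add: power_le_one)
  have M0: "0 \<le> M" using M[of 0] by simp
  note antimono = binomial_weights_antimono[OF \<theta> w, folded A_def]
  note increment = binomial_weights_increment[OF \<theta> w, folded A_def]
  have \<delta>_Suc: "\<delta> (Suc m) = (if m = 0 then A 1 else A m - A (Suc m))" for m
    using antimono[of m] A1_le by (auto simp: \<delta>_def a_def)
  \<comment> \<open>One jump up by A 1, then a monotone descent to A (Suc n).\<close>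
  have \<delta>_telescope: "(\<Sum>m\<le>Suc n. \<delta> m) = 2 * A 1 - A (Suc n)" for n
    by (induction n) (auto simp: \<delta>_Suc, auto simp: \<delta>_def)
  have \<delta>_sum: "(\<Sum>m\<le>n. \<delta> m) \<le> 2 * (1 - w)" for n
    using \<delta>_telescope A1_le A_nonneg[of n] w by (cases n) (auto simp: \<delta>_def)
  have \<delta>_le: "real m * \<delta> m \<le> 1 - w" for m
  proof (cases m)
    case (Suc n)
    then show ?thesis using increment[of n] A1_le by (auto simp: \<delta>_Suc)
  qed (use w in simp)
  have \<delta>_nonneg: "0 \<le> \<delta> m" for m by (simp add: \<delta>_def)
  have h_bound: "\<bar>h k\<bar> \<le> \<bar>\<psi> k\<bar> + (\<Sum>i<k. \<bar>\<Psi> i\<bar> * \<delta> (k - i))" for k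
  proof -
    have "h k = \<psi> k + (\<Sum>i<k. a (k - i) * \<psi> i)"
    proof -
      have "h k = (\<Sum>i<Suc k. \<psi> i * A (k - i))"
        unfolding h_def by (intro sum.cong) auto
      also have "\<dots> = \<psi> k + (\<Sum>i<k. \<psi> i * A (k - i))"
        by (simp add: A_def p_coeff_0)
      also have "(\<Sum>i<k. \<psi> i * A (k - i)) = (\<Sum>i<k. a (k - i) * \<psi> i)"
        by (intro sum.cong) (auto simp: a_def)
      finally show ?thesis .
    qed
    also have "(\<Sum>i<k. a (k - i) * \<psi> i) = (\<Sum>i<k. (a (k - i) - a (k - Suc i)) * \<Psi> i)"
      unfolding \<Psi>_def summation_by_parts by (simp add: a_def)
    finally have "\<bar>h k\<bar> \<le> \<bar>\<psi> k\<bar> + \<bar>\<Sum>i<k. (a (k - i) - a (k - Suc i)) * \<Psi> i\<bar>" by linarith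
    also have "\<bar>\<Sum>i<k. (a (k - i) - a (k - Suc i)) * \<Psi> i\<bar> \<le> (\<Sum>i<k. \<bar>(a (k - i) - a (k - Suc i)) * \<Psi> i\<bar>)"
      by (rule sum_abs)
    also have "\<dots> = (\<Sum>i<k. \<bar>\<Psi> i\<bar> * \<delta> (k - i))"
      by (intro sum.cong) (auto simp: \<delta>_def abs_mult)
    finally show ?thesis by simp
  qed
  have \<Psi>_sum: "(\<Sum>i<n. \<bar>\<Psi> i\<bar>) \<le> M" and \<Psi>_le: "real (Suc i) * \<bar>\<Psi> i\<bar> \<le> M" for n i
    unfolding \<Psi>_def by (rule partial_sums_of_null_series[OF sums M])+
  have "(\<Sum>k\<le>N. \<bar>h k\<bar>) \<le> (\<Sum>k\<le>N. \<bar>\<psi> k\<bar> + (\<Sum>i\<le>k. \<bar>\<Psi> i\<bar> * \<delta> (k - i)))"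
  proof (rule sum_mono)
    fix k
    have "(\<Sum>i<k. \<bar>\<Psi> i\<bar> * \<delta> (k - i)) \<le> (\<Sum>i\<le>k. \<bar>\<Psi> i\<bar> * \<delta> (k - i))"
      using \<delta>_nonneg by (intro sum_mono2) auto
    then show "\<bar>h k\<bar> \<le> \<bar>\<psi> k\<bar> + (\<Sum>i\<le>k. \<bar>\<Psi> i\<bar> * \<delta> (k - i))"
      using h_bound[of k] by linarith
  qed
  also have "\<dots> \<le> B + (\<Sum>i\<le>N. \<bar>\<Psi> i\<bar>) * (\<Sum>i\<le>N. \<delta> i)"
    unfolding sum.distrib using \<delta>_nonneg by (intro add_mono B convolution_sum_le) auto
  also have "\<dots> \<le> B + M * (2 * (1 - w))"
    using \<Psi>_sum[of "Suc N"] M0 \<delta>_nonneg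
    by (intro add_left_mono mult_mono \<delta>_sum sum_nonneg) (auto simp: lessThan_Suc_atMost)
  finally show "(\<Sum>k\<le>N. \<bar>h k\<bar>) \<le> B + 2 * (1 - w) * M" by (simp add: mult_ac)
  have "real k * \<bar>h k\<bar> \<le> real k * (\<bar>\<psi> k\<bar> + (\<Sum>i<k. \<bar>\<Psi> i\<bar> * \<delta> (k - i)))"
    by (intro mult_left_mono h_bound) auto
  also have "\<dots> = real k * \<bar>\<psi> k\<bar> + (\<Sum>i<k. real k * (\<bar>\<Psi> i\<bar> * \<delta> (k - i)))"
    by (simp only: distrib_left sum_distrib_left)
  also have "(\<Sum>i<k. real k * (\<bar>\<Psi> i\<bar> * \<delta> (k - i))) \<le> (\<Sum>i<k. (1 - w) * \<bar>\<Psi> i\<bar> + M * \<delta> (k - i))"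
  proof (rule sum_mono)
    fix i assume "i \<in> {..<k}"
    \<comment> \<open>Distribute the factor k over the two members of the convolution.\<close>
    then have "real k = real (k - i) + real i" by simp
    then have "real k * (\<bar>\<Psi> i\<bar> * \<delta> (k - i))
        = (real (k - i) * \<delta> (k - i)) * \<bar>\<Psi> i\<bar> + (real i * \<bar>\<Psi> i\<bar>) * \<delta> (k - i)"
      by (simp only: distrib_left distrib_right mult_ac)
    also have "\<dots> \<le> (1 - w) * \<bar>\<Psi> i\<bar> + M * \<delta> (k - i)"
    proof (intro add_mono mult_right_mono \<delta>_le \<delta>_nonneg abs_ge_zero)
      have "real i * \<bar>\<Psi> i\<bar> \<le> real (Suc i) * \<bar>\<Psi> i\<bar>" by (intro mult_right_mono) auto
      then show "real i * \<bar>\<Psi> i\<bar> \<le> M" using \<Psi>_le[of i] by linarith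
    qed
    finally show "real k * (\<bar>\<Psi> i\<bar> * \<delta> (k - i)) \<le> (1 - w) * \<bar>\<Psi> i\<bar> + M * \<delta> (k - i)" .
  qed
  also have "\<dots> = (1 - w) * (\<Sum>i<k. \<bar>\<Psi> i\<bar>) + M * (\<Sum>i<k. \<delta> (k - i))"
    by (simp add: sum.distrib sum_distrib_left)
  also have "(\<Sum>i<k. \<delta> (k - i)) = (\<Sum>i\<in>{1..k}. \<delta> i)"
    by (rule sum.reindex_bij_witness[of _ "\<lambda>i. k - i" "\<lambda>i. k - i"]) auto
  also have "(1 - w) * (\<Sum>i<k. \<bar>\<Psi> i\<bar>) + M * (\<Sum>i\<in>{1..k}. \<delta> i) \<le> (1 - w) * M + M * (2 * (1 - w))"
  proof (intro add_mono mult_left_mono \<Psi>_sum M0)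
    have "(\<Sum>i\<in>{1..k}. \<delta> i) \<le> (\<Sum>i\<le>k. \<delta> i)" using \<delta>_nonneg by (intro sum_mono2) auto
    then show "(\<Sum>i\<in>{1..k}. \<delta> i) \<le> 2 * (1 - w)" using \<delta>_sum[of k] by linarith
  qed (use w in auto)
  finally show "real k * \<bar>h k\<bar> \<le> real k * \<bar>\<psi> k\<bar> + 3 * (1 - w) * M" by (simp add: algebra_simps)
qed

text \<open>In each term one of the two indices is at least \<open>n / 2\<close>; there the pointwise bound is used, and the \<open>l\<^sup>1\<close>
bound for the other factor.\<close>
lemma convolution_pointwise:
  fixes h G :: "nat \<Rightarrow> real"
  assumes G: "\<And>m. 0 \<le> G m"
    and S: "(\<Sum>m\<le>n. G m) \<le> S" and T: "\<And>m. 1 \<le> m \<Longrightarrow> m \<le> n \<Longrightarrow> real m * G m \<le> T"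
    and B: "(\<Sum>k\<le>n. \<bar>h k\<bar>) \<le> B" and B': "\<And>k. k \<le> n \<Longrightarrow> n \<le> 2 * k \<Longrightarrow> real k * \<bar>h k\<bar> \<le> B'"
    and "0 \<le> T" "0 \<le> B'"
  shows "real n * \<bar>\<Sum>k\<le>n. h k * G (n - k)\<bar> \<le> 2 * B * T + 2 * B' * S"
proof -
  have "real n * \<bar>\<Sum>k\<le>n. h k * G (n - k)\<bar> \<le> real n * (\<Sum>k\<le>n. \<bar>h k * G (n - k)\<bar>)"
    by (intro mult_left_mono sum_abs) auto
  also have "\<dots> = (\<Sum>k\<le>n. real n * (\<bar>h k\<bar> * G (n - k)))"
    using G by (simp add: sum_distrib_left abs_mult)
  also have "\<dots> \<le> (\<Sum>k\<le>n. 2 * T * \<bar>h k\<bar> + 2 * B' * G (n - k))"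
  proof (rule sum_mono)
    fix k assume k: "k \<in> {..n}"
    show "real n * (\<bar>h k\<bar> * G (n - k)) \<le> 2 * T * \<bar>h k\<bar> + 2 * B' * G (n - k)"
    proof (cases "n \<le> 2 * k")
      case True
      have "real n * (\<bar>h k\<bar> * G (n - k)) \<le> (2 * real k) * (\<bar>h k\<bar> * G (n - k))"
        using True G by (intro mult_right_mono) auto
      also have "\<dots> = 2 * (real k * \<bar>h k\<bar>) * G (n - k)" by simp
      also have "\<dots> \<le> 2 * B' * G (n - k)"
        using B'[of k] True k G by (intro mult_right_mono mult_left_mono) auto
      finally show ?thesis using assms by (simp add: add_increasing)
    next
      case False
      have "real n * (\<bar>h k\<bar> * G (n - k)) \<le> (2 * real (n - k)) * (\<bar>h k\<bar> * G (n - k))"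
        using False G by (intro mult_right_mono) auto
      also have "\<dots> = 2 * (real (n - k) * G (n - k)) * \<bar>h k\<bar>" by simp
      also have "\<dots> \<le> 2 * T * \<bar>h k\<bar>"
        using T[of "n - k"] False by (intro mult_right_mono mult_left_mono) auto
      finally show ?thesis using assms by (simp add: add_increasing2)
    qed
  qed
  also have "\<dots> = 2 * T * (\<Sum>k\<le>n. \<bar>h k\<bar>) + 2 * B' * (\<Sum>k\<le>n. G (n - k))"
    by (simp add: sum.distrib sum_distrib_left)
  also have "(\<Sum>k\<le>n. G (n - k)) = (\<Sum>m\<le>n. G m)"
    by (rule sum.reindex_bij_witness[of _ "\<lambda>i. n - i" "\<lambda>i. n - i"]) auto
  also have "2 * T * (\<Sum>k\<le>n. \<bar>h k\<bar>) + 2 * B' * (\<Sum>m\<le>n. G m) \<le> 2 * T * B + 2 * B' * S"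
    using assms by (intro add_mono mult_left_mono) auto
  finally show ?thesis by (simp add: mult_ac)
qed

section \<open>Coefficients of p(z) / p(u z)\<close>

lemma p_fun_one_minus:
  assumes d: "bounded_weights D d" and "0 \<le> v" "v \<le> 1" "0 \<le> x" "x < 1"
  shows "p_fun (\<lambda>k. d k * (1 - v ^ k)) x = p_fun d x / p_fun d (v * x)"
proof -
  have "p_fun (\<lambda>k. d k * (1 - v ^ k) + d k * v ^ k) x
      = p_fun (\<lambda>k. d k * (1 - v ^ k)) x * p_fun (\<lambda>k. d k * v ^ k) x"
  proof (rule p_fun_add[of _ D])
    fix k :: nat assume k: "k \<ge> 1"
    show "\<bar>d k * (1 - v ^ k)\<bar> \<le> D"
      using bounded_weightsD[OF bounded_weights_one_minus[OF d] k, of v] assms by simp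
    show "\<bar>d k * v ^ k\<bar> \<le> D"
      using bounded_weightsD[OF d k] mult_left_le[of "v ^ k" "d k"] assms
      by (simp add: abs_mult power_le_one)
  qed (use assms in auto)
  then show ?thesis using p_fun_pos[of d "v * x"] by (simp add: p_fun_scale algebra_simps)
qed

text \<open>Removing \<open>\<theta>\<close> from all weights removes the factor \<open>((1 - w r) / (1 - r))^\<theta>\<close> from the value of
\<open>p(z) / p(w z)\<close> at \<open>r = rad n\<close>. The remaining steps replace \<open>w * r\<close> by \<open>w\<close>, which is harmless because
\<open>w \<le> r\<close> makes \<open>1 - w * r\<close> and \<open>1 - w\<close> comparable.\<close>
lemma p_fun_excess_weights_upper:
  assumes d: "bounded_weights (real K) d" and \<theta>: "\<And>k. k \<ge> 1 \<Longrightarrow> \<theta> \<le> d k" "0 \<le> \<theta>"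
    and n: "n \<ge> 1" and w: "0 \<le> w" "w \<le> rad n"
  shows "p_fun (\<lambda>k. (d k - \<theta>) * (1 - w ^ k)) (rad n)
    \<le> 2 ^ K * (p_fun d (rad n) / p_fun d w) * (1 / (real n * (1 - w))) powr \<theta>"
proof -
  define r where "r = rad n"
  have r: "0 < r" "r < 1" "1 - r \<le> 1 / real n" "w \<le> r"
    using rad_pos rad_less_one[OF n] one_minus_rad_upper w by (auto simp: r_def)
  have wr: "w * r \<le> w" "0 \<le> w * r" "w * r < 1" "w < 1"
    using w r mult_left_le[of r w] by auto
  have "p_fun (\<lambda>k. (d k - \<theta>) * (1 - w ^ k)) r
      \<le> p_fun (\<lambda>k. d k * (1 - w ^ k)) r * ((1 - r) / (1 - w * r)) powr \<theta>"
  proof (rule p_fun_compare[of _ "real K"])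
    fix k :: nat assume k: "k \<ge> 1"
    have wk: "0 \<le> 1 - w ^ k" "1 - w ^ k \<le> 1" using w wr by (auto simp: power_le_one)
    have "\<bar>(d k - \<theta>) * (1 - w ^ k)\<bar> \<le> real K * 1"
      unfolding abs_mult using bounded_weightsD[OF d k] \<theta>(1)[OF k] \<theta>(2) wk by (intro mult_mono) auto
    then show "\<bar>(d k - \<theta>) * (1 - w ^ k)\<bar> \<le> real K" by simp
    have "\<bar>d k * (1 - w ^ k)\<bar> \<le> real K * 1"
      unfolding abs_mult using bounded_weightsD[OF d k] wk by (intro mult_mono) auto
    then show "\<bar>d k * (1 - w ^ k)\<bar> \<le> real K" by simp
    show "(d k - \<theta>) * (1 - w ^ k) * r ^ k \<le> d k * (1 - w ^ k) * r ^ k + \<theta> * ((w * r) ^ k - r ^ k)"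
      by (simp add: algebra_simps power_mult_distrib)
  qed (use r wr in auto)
  also have "\<dots> \<le> 2 ^ K * (p_fun d r / p_fun d w) * (1 / (real n * (1 - w))) powr \<theta>"
  proof (intro mult_mono powr_mono2 \<theta>(2))
    have "p_fun d w \<le> p_fun d (w * r) * ((1 - w * r) / (1 - w)) ^ K"
      by (rule p_fun_ratio_upper[OF d]) (use wr in auto)
    also have "\<dots> \<le> p_fun d (w * r) * 2 ^ K"
    proof (intro mult_left_mono power_mono)
      have "w * (1 - r) \<le> 1 * (1 - w)" using w wr r by (intro mult_mono) auto
      then have "1 - w * r \<le> 2 * (1 - w)" by (simp add: algebra_simps)
      then show "(1 - w * r) / (1 - w) \<le> 2" using wr by (simp add: field_simps)
    qed (use wr p_fun_pos[of d "w * r"] in auto)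
    finally show "p_fun (\<lambda>k. d k * (1 - w ^ k)) r \<le> 2 ^ K * (p_fun d r / p_fun d w)"
      using p_fun_pos[of d r] p_fun_pos[of d w] p_fun_pos[of d "w * r"] w wr r
      by (subst p_fun_one_minus[OF d]) (auto simp: field_simps)
    show "(1 - r) / (1 - w * r) \<le> 1 / (real n * (1 - w))"
    proof -
      have "(1 - r) / (1 - w * r) \<le> (1 / real n) / (1 - w)"
        using r wr by (intro frac_le) auto
      then show ?thesis by simp
    qed
  qed (use p_fun_pos[of d r] p_fun_pos[of d w] r wr in auto)
  finally show ?thesis by (simp add: r_def)
qed

lemma sum_shift_le:
  fixes g :: "nat \<Rightarrow> real"
  assumes "\<And>i. 0 \<le> g i"
  shows "(\<Sum>k\<le>N. if j \<le> k then g (k - j) else 0) \<le> (\<Sum>i\<le>N. g i)"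
proof -
  have "(\<Sum>k\<le>N. if j \<le> k then g (k - j) else 0) = (\<Sum>k\<in>{j..N}. g (k - j))"
    by (intro sum.mono_neutral_cong_right) auto
  also have "\<dots> = (\<Sum>i\<in>(\<lambda>k. k - j) ` {j..N}. g i)"
    by (subst sum.reindex) (auto simp: inj_on_def)
  also have "\<dots> \<le> (\<Sum>i\<le>N. g i)"
    using assms by (intro sum_mono2) auto
  finally show ?thesis .
qed

text \<open>The central estimate. With \<open>F = A G\<close> and \<open>\<psi>(z) = z^j X(z) - Y(z)\<close>, where \<open>X(z) = p(w z) / p(u z)\<close> and
\<open>Y(z) = p(w z) / p(u)\<close>, the difference is the coefficient of \<open>z^n\<close> in \<open>A \<psi> G\<close>. Taking \<open>w \<ge> u\<close> makes the
coefficients of \<open>X\<close> nonnegative, and \<open>w \<ge> rad j\<close> makes the shift by \<open>j\<close> invisible at the scale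
\<open>1 / (1 - w)\<close>. Both \<open>X\<close> and \<open>Y\<close> take the value \<open>Q\<close> at 1. The assumption \<open>4 * j \<le> n\<close> is used where \<open>k \<ge> n / 2\<close>
has to imply \<open>k - j \<ge> k / 2\<close>.\<close>
lemma coeff_quotient_approx:
  assumes d: "bounded_weights (real K) d" and \<theta>: "\<And>k. k \<ge> 1 \<Longrightarrow> \<theta> \<le> d k" "0 \<le> \<theta>" "\<theta> \<le> 1"
    and j: "j \<ge> 1" "4 * j \<le> n" and u: "0 \<le> u" "u \<le> rad n"
  defines "w \<equiv> max u (rad j)"
  shows "real n * \<bar>p_coeff (\<lambda>k. d k * (1 - u ^ k)) (n - j) - p_coeff d n / p_fun d u\<bar>
    \<le> 2 ^ K * (24 * real K ^ 2 + 78 * real K + 18)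
        * (p_fun d (rad n) / p_fun d u) * (1 / (real n * (1 - w))) powr \<theta>"
proof -
  have n: "n \<ge> 1" using j by simp
  have w: "0 < w" "u \<le> w" "rad j \<le> w" "w \<le> rad n" "w < 1" "w \<le> 1"
    using rad_pos[of j] rad_mono[of j n] j u rad_less_one[OF n] by (auto simp: w_def)
  define Q where "Q = p_fun d w / p_fun d u"
  have Q0: "0 < Q" by (simp add: Q_def p_fun_pos)
  define X where "X = p_coeff (\<lambda>k. d k * (w ^ k - u ^ k))"
  define Y where "Y = (\<lambda>k. p_coeff d k * w ^ k / p_fun d u)"
  define \<psi> where "\<psi> = (\<lambda>k. (if j \<le> k then X (k - j) else 0) - Y k)"
  define A where "A = p_coeff (\<lambda>k. \<theta> * (1 - w ^ k))"
  define G where "G = p_coeff (\<lambda>k. (d k - \<theta>) * (1 - w ^ k))"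
  define F where "F = p_coeff (\<lambda>k. d k * (1 - w ^ k))"
  define h where "h = (\<lambda>k. \<Sum>i=0..k. \<psi> i * A (k - i))"
  have bX: "bounded_weights K (\<lambda>k. d k * (w ^ k - u ^ k))"
    by (rule bounded_weights_damped[OF d]) (use u w in auto)
  have X_nonneg: "0 \<le> X k" and Y_nonneg: "0 \<le> Y k" for k
    using p_coeff_weights_nonneg[OF bX] p_coeff_weights_nonneg[OF d] w p_fun_pos[of d u]
    by (auto simp: X_def Y_def)

  \<comment> \<open>Rescaling by w turns X into power series coefficients at a point inside the disc.\<close>
  define \<rho> where "\<rho> = u / w"
  have \<rho>: "0 \<le> \<rho>" "\<rho> \<le> 1" "\<rho> * w = u" using u w by (auto simp: \<rho>_def)
  have bf: "bounded_weights K (\<lambda>k. d k * (1 - \<rho> ^ k))"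
    by (rule bounded_weights_one_minus[OF d \<rho>(1,2)])
  have X_eq: "X k = p_coeff (\<lambda>k. d k * (1 - \<rho> ^ k)) k * w ^ k" for k
  proof -
    have "(\<lambda>k. d k * (w ^ k - u ^ k)) = (\<lambda>k. d k * (1 - \<rho> ^ k) * w ^ k)"
      by (simp add: algebra_simps \<rho>(3)[symmetric] power_mult_distrib)
    then show ?thesis unfolding X_def by (simp only: p_coeff_scale)
  qed
  have XQ: "p_fun (\<lambda>k. d k * (1 - \<rho> ^ k)) w = Q"
    using p_fun_one_minus[OF d \<rho>(1,2), of w] w by (simp add: Q_def \<rho>)
  have X_sums: "X sums Q"
    using p_coeff_weights_sums[OF bf, of w] w by (simp add: XQ flip: X_eq)
  have Y_sums: "Y sums Q"
    unfolding Y_def Q_def by (intro sums_divide p_coeff_weights_sums[OF d]) (use w in auto)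
  have partial: "(\<Sum>i\<le>N. f i) \<le> s" if "f sums s" "\<And>i. 0 \<le> f i" for f :: "nat \<Rightarrow> real" and s N
    using sum_le_suminf[OF sums_summable[OF that(1)], of "{..N}"] that by (simp add: sums_iff)
  have odds: "w / (1 - w) \<le> 1 / (1 - w)" using w by (simp add: divide_right_mono)
  have X_moment: "(\<Sum>k\<le>N. real k * X k) \<le> K * Q / (1 - w)" for N
  proof -
    note M = first_moment[OF bf, of w]
    have "(\<Sum>k\<le>N. real k * X k) \<le> (\<Sum>k. real k * X k)"
      using M(1) w X_nonneg by (intro sum_le_suminf) (auto simp: X_eq mult_ac)
    also have "\<dots> \<le> K * (w / (1 - w)) * Q"
      using M(2) w by (simp add: X_eq XQ mult_ac)
    also have "\<dots> \<le> K * (1 / (1 - w)) * Q"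
      using odds Q0 by (intro mult_right_mono mult_left_mono) auto
    finally show ?thesis by simp
  qed
  have Y_moment: "(\<Sum>k\<le>N. real k * Y k) \<le> K * Q / (1 - w)" for N
  proof -
    note M = first_moment[OF d, of w]
    have "(\<Sum>k\<le>N. real k * p_coeff d k * w ^ k) \<le> (\<Sum>k. real k * p_coeff d k * w ^ k)"
      using M(1) w p_coeff_weights_nonneg[OF d] by (intro sum_le_suminf) auto
    also have "\<dots> \<le> K * (w / (1 - w)) * p_fun d w"
      using M(2) w by simp
    also have "\<dots> \<le> K * (1 / (1 - w)) * p_fun d w"
      using odds p_fun_pos[of d w] by (intro mult_right_mono mult_left_mono) auto
    finally have "(\<Sum>k\<le>N. real k * p_coeff d k * w ^ k) / p_fun d u \<le> K * (1 / (1 - w)) * p_fun d w / p_fun d u"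
      using p_fun_pos[of d u] by (intro divide_right_mono) auto
    then show ?thesis by (simp add: Y_def Q_def sum_divide_distrib mult_ac)
  qed
  have j_le: "real j \<le> 1 / (1 - w)"
  proof -
    have "1 - w \<le> 1 / real j" using one_minus_rad_upper[of j] w by linarith
    then show ?thesis using w j by (simp add: field_simps)
  qed
  have shift_sums: "(\<lambda>k. if j \<le> k then X (k - j) else 0) sums Q"
    using X_sums sums_iff_shift[of "\<lambda>k. if j \<le> k then X (k - j) else 0" j Q] by simp
  have \<psi>_sums: "\<psi> sums 0"
    using sums_diff[OF shift_sums Y_sums] by (simp add: \<psi>_def)
  have \<psi>_abs: "\<bar>\<psi> k\<bar> \<le> (if j \<le> k then X (k - j) else 0) + Y k" for k
    using X_nonneg[of "k - j"] Y_nonneg[of k] by (auto simp: \<psi>_def)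
  have \<psi>_B: "(\<Sum>k\<le>N. \<bar>\<psi> k\<bar>) \<le> 2 * Q" for N
  proof -
    have "(\<Sum>k\<le>N. \<bar>\<psi> k\<bar>) \<le> (\<Sum>k\<le>N. if j \<le> k then X (k - j) else 0) + (\<Sum>k\<le>N. Y k)"
      unfolding sum.distrib[symmetric] by (intro sum_mono \<psi>_abs)
    also have "\<dots> \<le> Q + Q"
      by (intro add_mono order_trans[OF sum_shift_le] partial[OF X_sums] partial[OF Y_sums] X_nonneg Y_nonneg)
    finally show ?thesis by simp
  qed
  define M where "M = (2 * real K + 1) * Q / (1 - w)"
  have \<psi>_M: "(\<Sum>k\<le>N. real k * \<bar>\<psi> k\<bar>) \<le> M" for N
  proof -
    have "(\<Sum>k\<le>N. real k * \<bar>\<psi> k\<bar>)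
        \<le> (\<Sum>k\<le>N. if j \<le> k then real (k - j + j) * X (k - j) else 0) + (\<Sum>k\<le>N. real k * Y k)"
      unfolding sum.distrib[symmetric]
    proof (rule sum_mono)
      fix k
      have "real k * \<bar>\<psi> k\<bar> \<le> real k * ((if j \<le> k then X (k - j) else 0) + Y k)"
        by (intro mult_left_mono \<psi>_abs) auto
      then show "real k * \<bar>\<psi> k\<bar> \<le> (if j \<le> k then real (k - j + j) * X (k - j) else 0) + real k * Y k"
        by (auto simp: distrib_left)
    qed
    also have "(\<Sum>k\<le>N. if j \<le> k then real (k - j + j) * X (k - j) else 0) \<le> (\<Sum>i\<le>N. real (i + j) * X i)"
      by (rule sum_shift_le) (use X_nonneg in auto)
    also have "\<dots> = (\<Sum>i\<le>N. real i * X i) + real j * (\<Sum>i\<le>N. X i)"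
      by (simp add: distrib_right sum.distrib sum_distrib_left)
    also have "\<dots> + (\<Sum>k\<le>N. real k * Y k) \<le> K * Q / (1 - w) + 1 / (1 - w) * Q + K * Q / (1 - w)"
      using w X_nonneg by (intro add_mono X_moment Y_moment mult_mono j_le partial[OF X_sums] sum_nonneg) auto
    also have "\<dots> = M" by (simp add: M_def distrib_right add_divide_distrib)
    finally show ?thesis by simp
  qed
  have vM: "(1 - w) * M = (2 * real K + 1) * Q" using w by (simp add: M_def)

  have smooth: "(\<Sum>k\<le>N. \<bar>h k\<bar>) \<le> 2 * Q + 2 * (1 - w) * M"
    "real k * \<bar>h k\<bar> \<le> real k * \<bar>\<psi> k\<bar> + 3 * (1 - w) * M" for N k
    unfolding h_def A_def
    by (rule binomial_smoothing[OF \<theta>(2,3) less_imp_le[OF w(1)] w(6) \<psi>_sums \<psi>_M \<psi>_B])+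
  have h_sum: "(\<Sum>k\<le>n. \<bar>h k\<bar>) \<le> (4 * real K + 4) * Q"
  proof -
    have "(\<Sum>k\<le>n. \<bar>h k\<bar>) \<le> 2 * Q + 2 * ((1 - w) * M)"
      using smooth(1)[of n] by (simp only: mult.assoc)
    then show ?thesis unfolding vM by (simp add: algebra_simps)
  qed
  have h_point: "real k * \<bar>h k\<bar> \<le> (9 * real K + 3) * Q" if "n \<le> 2 * k" for k
  proof -
    have kj: "2 * j \<le> k" "1 \<le> k" "1 \<le> k - j" using that j by auto
    have "real (k - j) * X (k - j) \<le> K * (\<Sum>i\<le>k - j. X i)"
      unfolding X_def by (rule p_coeff_le_partial_sum) (use bounded_weightsD[OF bX] kj in auto)
    also have "\<dots> \<le> K * Q" by (intro mult_left_mono partial[OF X_sums] X_nonneg) auto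
    finally have x: "real (k - j) * X (k - j) \<le> K * Q" .
    have "real k * X (k - j) \<le> (2 * real (k - j)) * X (k - j)"
      using kj X_nonneg by (intro mult_right_mono) auto
    then have x': "real k * X (k - j) \<le> 2 * (K * Q)" using x by linarith
    have bY: "bounded_weights K (\<lambda>k. d k * w ^ k)"
      unfolding bounded_weights_def
    proof (intro allI impI conjI)
      fix k :: nat assume k: "k \<ge> 1"
      show "0 \<le> d k * w ^ k" using bounded_weightsD[OF d k] w by simp
      have "d k * w ^ k \<le> real K * 1"
        using bounded_weightsD[OF d k] w by (intro mult_mono) (auto simp: power_le_one)
      then show "d k * w ^ k \<le> real K" by simp
    qed
    have "real k * (p_coeff d k * w ^ k) \<le> K * (\<Sum>i\<le>k. p_coeff d i * w ^ i)"
      unfolding p_coeff_scale[symmetric]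
      by (rule p_coeff_le_partial_sum) (use bounded_weightsD[OF bY] kj in auto)
    then have "real k * (p_coeff d k * w ^ k) / p_fun d u \<le> K * (\<Sum>i\<le>k. p_coeff d i * w ^ i) / p_fun d u"
      using p_fun_pos[of d u] by (intro divide_right_mono) auto
    then have "real k * Y k \<le> K * (\<Sum>i\<le>k. Y i)"
      by (simp add: Y_def flip: sum_divide_distrib)
    also have "\<dots> \<le> K * Q" by (intro mult_left_mono partial[OF Y_sums] Y_nonneg) auto
    finally have y: "real k * Y k \<le> K * Q" .
    have "real k * \<bar>\<psi> k\<bar> \<le> real k * ((if j \<le> k then X (k - j) else 0) + Y k)"
      by (intro mult_left_mono \<psi>_abs) auto
    also have "\<dots> = real k * X (k - j) + real k * Y k" using kj by (simp add: distrib_left)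
    also have "\<dots> \<le> 2 * (K * Q) + K * Q" using x' y by (rule add_mono)
    finally have "real k * \<bar>h k\<bar> \<le> 3 * (K * Q) + 3 * ((1 - w) * M)"
      using smooth(2)[of k] by (simp only: mult.assoc)
    then show ?thesis unfolding vM by (simp add: algebra_simps)
  qed

  define \<Gamma> where "\<Gamma> = p_fun (\<lambda>k. (d k - \<theta>) * (1 - w ^ k)) (rad n)"
  have "bounded_weights K (\<lambda>k. d k - \<theta>)"
    using d \<theta> unfolding bounded_weights_def by (auto intro: order_trans[of _ "d _"])
  then have bG: "bounded_weights K (\<lambda>k. (d k - \<theta>) * (1 - w ^ k))"
    by (rule bounded_weights_one_minus) (use w in auto)
  have G_nonneg: "0 \<le> G m" for m unfolding G_def by (rule p_coeff_weights_nonneg[OF bG])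
  have G_sum: "(\<Sum>m\<le>n. G m) \<le> 3 * \<Gamma>"
    unfolding G_def \<Gamma>_def by (rule p_coeff_partial_sum_le[OF bG n])
  have G_point: "real m * G m \<le> 3 * real K * \<Gamma>" if "1 \<le> m" "m \<le> n" for m
  proof -
    have "real m * G m \<le> 3 * real K * p_fun (\<lambda>k. (d k - \<theta>) * (1 - w ^ k)) (rad m)"
      unfolding G_def by (rule p_coeff_upper[OF bG that(1)])
    also have "\<dots> \<le> 3 * real K * \<Gamma>"
      unfolding \<Gamma>_def using rad_pos[of m] rad_mono[OF that] rad_less_one[OF n]
      by (intro mult_left_mono p_fun_mono[OF bG]) auto
    finally show ?thesis .
  qed
  have \<Gamma>0: "0 < \<Gamma>" by (simp add: \<Gamma>_def p_fun_pos)

  have main: "p_coeff (\<lambda>k. d k * (1 - u ^ k)) (n - j) - p_coeff d n / p_fun d u = (\<Sum>k\<le>n. h k * G (n - k))"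
  proof -
    have F_fps: "Abs_fps F = Abs_fps A * Abs_fps G"
    proof (rule fps_ext)
      fix m
      have "(\<lambda>k. d k * (1 - w ^ k)) = (\<lambda>k. \<theta> * (1 - w ^ k) + (d k - \<theta>) * (1 - w ^ k))"
        by (simp add: algebra_simps)
      then show "fps_nth (Abs_fps F) m = fps_nth (Abs_fps A * Abs_fps G) m"
        by (simp add: F_def A_def G_def fps_mult_nth p_coeff_add)
    qed
    have fX: "p_coeff (\<lambda>k. d k * (1 - u ^ k)) m = (\<Sum>i=0..m. X i * F (m - i))" for m
    proof -
      have "(\<lambda>k. d k * (1 - u ^ k)) = (\<lambda>k. d k * (w ^ k - u ^ k) + d k * (1 - w ^ k))"
        by (simp add: algebra_simps)
      then show ?thesis by (simp add: X_def F_def p_coeff_add)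
    qed
    have fY: "p_coeff d m / p_fun d u = (\<Sum>i=0..m. Y i * F (m - i))" for m
    proof -
      have "p_coeff d m = p_coeff (\<lambda>k. d k * w ^ k + d k * (1 - w ^ k)) m"
        by (simp add: algebra_simps)
      then show ?thesis
        by (simp add: Y_def F_def p_coeff_add p_coeff_scale sum_divide_distrib)
    qed
    have "p_coeff (\<lambda>k. d k * (1 - u ^ k)) (n - j) = (\<Sum>i=0..n. (if j \<le> i then X (i - j) else 0) * F (n - i))"
    proof -
      have "(\<Sum>i=0..n. (if j \<le> i then X (i - j) else 0) * F (n - i)) = (\<Sum>i=j..n. X (i - j) * F (n - i))"
        by (intro sum.mono_neutral_cong_right) auto
      also have "\<dots> = (\<Sum>i=0..n - j. X i * F (n - j - i))"
        by (rule sum.reindex_bij_witness[of _ "\<lambda>i. i + j" "\<lambda>i. i - j"]) (use j in auto)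
      finally show ?thesis by (simp add: fX)
    qed
    then have "p_coeff (\<lambda>k. d k * (1 - u ^ k)) (n - j) - p_coeff d n / p_fun d u
        = (\<Sum>i=0..n. \<psi> i * F (n - i))"
      by (simp add: fY \<psi>_def left_diff_distrib sum_subtractf)
    also have "\<dots> = fps_nth (Abs_fps \<psi> * Abs_fps F) n" by (simp add: fps_mult_nth)
    also have "\<dots> = fps_nth ((Abs_fps \<psi> * Abs_fps A) * Abs_fps G) n" by (simp only: F_fps mult.assoc)
    also have "\<dots> = (\<Sum>k\<le>n. h k * G (n - k))"
      by (simp add: fps_mult_nth[of _ "Abs_fps G"] fps_mult_nth[of _ "Abs_fps A"] h_def atMost_atLeast0)
    finally show ?thesis .
  qed
  have "real n * \<bar>p_coeff (\<lambda>k. d k * (1 - u ^ k)) (n - j) - p_coeff d n / p_fun d u\<bar>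
      \<le> 2 * ((4 * real K + 4) * Q) * (3 * real K * \<Gamma>) + 2 * ((9 * real K + 3) * Q) * (3 * \<Gamma>)"
    unfolding main
    by (rule convolution_pointwise) (use G_nonneg G_sum G_point h_sum h_point \<Gamma>0 Q0 in auto)
  also have "\<dots> = (24 * real K ^ 2 + 78 * real K + 18) * Q * \<Gamma>"
    by (simp add: algebra_simps power2_eq_square)
  also have "\<dots> \<le> (24 * real K ^ 2 + 78 * real K + 18) * Q
      * (2 ^ K * (p_fun d (rad n) / p_fun d w) * (1 / (real n * (1 - w))) powr \<theta>)"
    unfolding \<Gamma>_def using w Q0
    by (intro mult_left_mono p_fun_excess_weights_upper[OF d \<theta>(1,2) n]) auto
  also have "\<dots> = 2 ^ K * (24 * real K ^ 2 + 78 * real K + 18)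
      * (p_fun d (rad n) / p_fun d u) * (1 / (real n * (1 - w))) powr \<theta>"
    using p_fun_pos[of d w] by (simp add: Q_def)
  finally show ?thesis .
qed

section \<open>Kernels\<close>

text \<open>Integration by parts lowers \<open>l\<close> and raises \<open>m\<close>.\<close>

lemma beta_integral_bound:
  "integral {0..1} (\<lambda>u::real. u ^ m * (1 - u) ^ l) \<le> fact l / real (Suc m) ^ Suc l"
proof (induction l arbitrary: m)
  case 0
  have "((\<lambda>u::real. u ^ m) has_integral (1 ^ Suc m / real (Suc m) - 0 ^ Suc m / real (Suc m))) {0..1}"
  proof (rule fundamental_theorem_of_calculus)
    fix x :: real
    have "((\<lambda>u. u ^ Suc m / real (Suc m)) has_real_derivative
        (real (Suc m) * x ^ (Suc m - Suc 0) / real (Suc m))) (at x within {0..1})"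
      by (intro DERIV_cdivide DERIV_pow)
    then show "((\<lambda>u. u ^ Suc m / real (Suc m)) has_vector_derivative x ^ m) (at x within {0..1})"
      by (simp add: has_real_derivative_iff_has_vector_derivative del: of_nat_Suc power_Suc)
  qed simp
  then show ?case by (simp add: integral_unique del: of_nat_Suc)
next
  case (Suc l)
  let ?I = "\<lambda>m l. integral {0..1} (\<lambda>u::real. u ^ m * (1 - u) ^ l)"
  have int: "(\<lambda>u::real. u ^ m * (1 - u) ^ l) integrable_on {0..1}" for m l
    by (intro integrable_continuous_interval continuous_intros)
  have parts: "((\<lambda>u::real. real (Suc m) * (u ^ m * (1 - u) ^ Suc l) - real (Suc l) * (u ^ Suc m * (1 - u) ^ l))
      has_integral (1 ^ Suc m * (1 - 1) ^ Suc l - 0 ^ Suc m * (1 - 0) ^ Suc l)) {0..1}"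
  proof (rule fundamental_theorem_of_calculus)
    fix x :: real
    have "((\<lambda>u. u ^ Suc m * (1 - u) ^ Suc l) has_real_derivative
        (1 + real m) * (1 * x ^ m) * (1 - x) ^ Suc l + (1 + real l) * ((0 - 1) * (1 - x) ^ l) * x ^ Suc m)
        (at x within {0..1})"
      by (intro DERIV_mult DERIV_power_Suc DERIV_ident DERIV_diff DERIV_const)
    moreover have "(1 + real m) * (1 * x ^ m) * (1 - x) ^ Suc l + (1 + real l) * ((0 - 1) * (1 - x) ^ l) * x ^ Suc m
        = real (Suc m) * (x ^ m * (1 - x) ^ Suc l) - real (Suc l) * (x ^ Suc m * (1 - x) ^ l)"
      by (simp add: algebra_simps)
    ultimately show "((\<lambda>u. u ^ Suc m * (1 - u) ^ Suc l) has_vector_derivative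
        real (Suc m) * (x ^ m * (1 - x) ^ Suc l) - real (Suc l) * (x ^ Suc m * (1 - x) ^ l)) (at x within {0..1})"
      by (simp only: has_real_derivative_iff_has_vector_derivative)
  qed simp
  have split: "((\<lambda>u::real. real (Suc m) * (u ^ m * (1 - u) ^ Suc l) - real (Suc l) * (u ^ Suc m * (1 - u) ^ l))
      has_integral (real (Suc m) * ?I m (Suc l) - real (Suc l) * ?I (Suc m) l)) {0..1}"
    by (intro has_integral_diff has_integral_mult_right integrable_integral int)
  have "real (Suc m) * ?I m (Suc l) = real (Suc l) * ?I (Suc m) l"
    using has_integral_unique[OF parts split] by simp
  also have "\<dots> \<le> real (Suc l) * (fact l / real (Suc (Suc m)) ^ Suc l)"
    by (intro mult_left_mono Suc.IH) auto
  also have "\<dots> \<le> real (Suc l) * (fact l / real (Suc m) ^ Suc l)"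
    by (intro mult_left_mono divide_left_mono power_mono) auto
  finally have "?I m (Suc l) \<le> real (Suc l) * (fact l / real (Suc m) ^ Suc l) / real (Suc m)"
    by (simp add: field_simps del: of_nat_Suc power_Suc)
  also have "\<dots> = fact (Suc l) / real (Suc m) ^ Suc (Suc l)"
    by (simp add: mult_ac del: of_nat_Suc)
  finally show ?case .
qed

text \<open>The constant of the next bound: \<open>(1 + x) ^ K \<le> 2 ^ K * (1 + x ^ K)\<close> leaves two beta integrals.\<close>
definition kernel_const :: "nat \<Rightarrow> real \<Rightarrow> nat \<Rightarrow> real"
  where "kernel_const a c K = 2 ^ K * (fact a + c ^ K * fact (a + K))"

lemma kernel_const_pos: "0 \<le> c \<Longrightarrow> 0 < kernel_const a c K"
  unfolding kernel_const_def by (intro mult_pos_pos add_pos_nonneg) auto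

lemma kernel_integral_bound:
  fixes c :: real
  assumes c: "0 \<le> c" and j: "j \<ge> 1"
  shows "integral {0..1} (\<lambda>u. u ^ (j - 1) * ((1 - u) ^ a * (1 + c * real j * (1 - u)) ^ K))
    \<le> kernel_const a c K / real j ^ Suc a"
proof -
  have Suc: "real (Suc (j - 1)) = real j" using j by simp
  let ?I = "\<lambda>l. integral {0..1} (\<lambda>u::real. u ^ (j - 1) * (1 - u) ^ l)"
  have int: "(\<lambda>u::real. u ^ (j - 1) * (1 - u) ^ l) integrable_on {0..1}" for l
    by (intro integrable_continuous_interval continuous_intros)
  have "integral {0..1} (\<lambda>u. u ^ (j - 1) * ((1 - u) ^ a * (1 + c * real j * (1 - u)) ^ K))
      \<le> integral {0..1} (\<lambda>u. 2 ^ K * (u ^ (j - 1) * (1 - u) ^ a + (c * real j) ^ K * (u ^ (j - 1) * (1 - u) ^ (a + K))))"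
  proof (intro integral_le integrable_continuous_interval continuous_intros)
    fix u :: real assume u: "u \<in> {0..1}"
    define x where "x = c * real j * (1 - u)"
    have x: "0 \<le> x" using u c by (simp add: x_def)
    have "(1 + x) ^ K \<le> (2 * max 1 x) ^ K" using x by (intro power_mono) auto
    also have "\<dots> = 2 ^ K * max 1 x ^ K" by (simp add: power_mult_distrib)
    also have "\<dots> \<le> 2 ^ K * (1 + x ^ K)" using x by (intro mult_left_mono) (auto simp: max_def)
    finally have *: "(1 + x) ^ K \<le> 2 ^ K * (1 + x ^ K)" .
    have "u ^ (j - 1) * ((1 - u) ^ a * (1 + x) ^ K) \<le> u ^ (j - 1) * ((1 - u) ^ a * (2 ^ K * (1 + x ^ K)))"
      using u by (intro mult_left_mono *) auto
    also have "\<dots> = 2 ^ K * (u ^ (j - 1) * (1 - u) ^ a + (c * real j) ^ K * (u ^ (j - 1) * (1 - u) ^ (a + K)))"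
    proof -
      have "x ^ K = (c * real j) ^ K * (1 - u) ^ K" by (simp only: x_def power_mult_distrib)
      then show ?thesis by (simp only: power_add distrib_left mult_ac mult_1_right)
    qed
    finally show "u ^ (j - 1) * ((1 - u) ^ a * (1 + c * real j * (1 - u)) ^ K)
      \<le> 2 ^ K * (u ^ (j - 1) * (1 - u) ^ a + (c * real j) ^ K * (u ^ (j - 1) * (1 - u) ^ (a + K)))"
      by (simp add: x_def)
  qed
  also have "\<dots> = 2 ^ K * (?I a + (c * real j) ^ K * ?I (a + K))"
    by (intro integral_unique has_integral_mult_right has_integral_add integrable_integral int)
  also have "\<dots> \<le> 2 ^ K * (fact a / real j ^ Suc a + (c * real j) ^ K * (fact (a + K) / real j ^ Suc (a + K)))"
    using c beta_integral_bound[of "j - 1" a] beta_integral_bound[of "j - 1" "a + K"]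
    unfolding Suc by (intro mult_left_mono add_mono) auto
  also have "\<dots> = kernel_const a c K / real j ^ Suc a"
    using j by (simp add: kernel_const_def power_mult_distrib power_add field_simps)
  finally show ?thesis .
qed

text \<open>The weights with which \<open>S j\<close> enters the unnormalised mean of index \<open>n\<close> and the value \<open>g x\<close>.\<close>
definition sum_kernel :: "(nat \<Rightarrow> real) \<Rightarrow> nat \<Rightarrow> nat \<Rightarrow> real"
  where "sum_kernel d n j = integral {0..1} (\<lambda>u. u ^ (j - 1) * p_coeff (\<lambda>k. d k * (1 - u ^ k)) (n - j))"

definition value_kernel :: "(nat \<Rightarrow> real) \<Rightarrow> real \<Rightarrow> nat \<Rightarrow> real"
  where "value_kernel d x j = integral {0..x} (\<lambda>u. u ^ (j - 1) / p_fun d u)"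

lemma p_coeff_one_minus_expand:
  "p_coeff (\<lambda>k. d k * (1 - u ^ k)) m = (\<Sum>i=0..m. p_coeff d i * (p_coeff (\<lambda>k. - d k) (m - i) * u ^ (m - i)))"
proof -
  have "(\<lambda>k. d k * (1 - u ^ k)) = (\<lambda>k. d k + - d k * u ^ k)" by (simp add: algebra_simps)
  then show ?thesis by (simp only: p_coeff_add p_coeff_scale)
qed

lemma continuous_on_p_coeff_one_minus:
  "continuous_on S (\<lambda>u. p_coeff (\<lambda>k. d k * (1 - u ^ k)) m)"
  unfolding p_coeff_one_minus_expand by (intro continuous_intros)

lemma continuous_on_p_fun:
  assumes d: "bounded_weights D d" and x: "x < 1"
  shows "continuous_on {0..x} (p_fun d)"
proof (rule continuous_at_imp_continuous_on, rule ballI)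
  fix u assume u: "u \<in> {0..x}"
  define K where "K = (1 + x) / 2"
  have K: "u < K" "K < 1" "0 < K" using u x by (auto simp: K_def)
  have "isCont (\<lambda>u. \<Sum>i. p_coeff d i * u ^ i) u"
    by (rule isCont_powser[of _ K])
      (use K u in \<open>auto intro!: sums_summable[OF p_coeff_weights_sums[OF d]]\<close>)
  moreover have "eventually (\<lambda>u. (\<Sum>i. p_coeff d i * u ^ i) = p_fun d u) (nhds u)"
  proof -
    have "eventually (\<lambda>u. u \<in> {-1<..<1}) (nhds u)"
      by (rule eventually_nhds_in_open) (use u K in auto)
    then show ?thesis
      by eventually_elim (auto intro!: sums_unique[symmetric] p_coeff_weights_sums[OF d])
  qed
  ultimately show "isCont (p_fun d) u" by (simp add: isCont_cong)
qed

lemma continuous_on_inverse_p_fun: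
  assumes "bounded_weights D d" "x < 1"
  shows "continuous_on {0..x} (\<lambda>u. u ^ m / p_fun d u)"
  by (intro continuous_intros continuous_on_p_fun[OF assms]) (simp add: p_fun_pos less_imp_neq[symmetric])

lemma value_kernel_nonneg:
  assumes "bounded_weights D d" "x < 1"
  shows "0 \<le> value_kernel d x j"
  unfolding value_kernel_def
  by (intro integral_nonneg integrable_continuous_interval continuous_on_inverse_p_fun[OF assms])
    (simp add: p_fun_pos less_imp_le)

text \<open>For \<open>u \<le> r\<close> one has \<open>p(r) / p(u) \<le> ((1 - u) / (1 - r)) ^ K\<close>, and since \<open>r / (1 - r) \<le> n \<le> 4 * j\<close> this is at most
\<open>(1 + 4 * j * (1 - u / r)) ^ K\<close>. Stretching \<open>{0..1}\<close> to \<open>{0..r}\<close> produces the factor \<open>r ^ j\<close>.\<close>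
lemma value_kernel_bound:
  assumes d: "bounded_weights (real K) d" and n: "n \<ge> 1" and j: "n \<le> 4 * j"
  shows "value_kernel d (rad n) j \<le> kernel_const 0 4 K * (rad n ^ j / (real j * p_fun d (rad n)))"
proof -
  define r where "r = rad n"
  have r: "0 < r" "r < 1" "r / (1 - r) \<le> real n"
    using rad_pos rad_less_one[OF n] rad_odds[OF n] by (auto simp: r_def)
  have j1: "j \<ge> 1" using n j by simp
  define f where "f = (\<lambda>s::real. s ^ (j - 1) * ((1 - s) ^ 0 * (1 + 4 * real j * (1 - s)) ^ K))"
  have int: "(f has_integral integral {0..1} f) {0..1}"
    unfolding f_def by (intro integrable_integral integrable_continuous_interval continuous_intros)
  have scaled: "((\<lambda>u. f (u / r)) has_integral (r * integral {0..1} f)) {0..r}"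
    using has_integral_affinity'[of f "integral {0..1} f" 0 1 "1 / r" 0] int r
    by (simp add: field_simps)
  have "value_kernel d r j \<le> integral {0..r} (\<lambda>u. r ^ (j - 1) / p_fun d r * f (u / r))"
    unfolding value_kernel_def
  proof (rule integral_le)
    show "(\<lambda>u. u ^ (j - 1) / p_fun d u) integrable_on {0..r}"
      by (intro integrable_continuous_interval continuous_on_inverse_p_fun[OF d r(2)])
    show "(\<lambda>u. r ^ (j - 1) / p_fun d r * f (u / r)) integrable_on {0..r}"
      by (rule has_integral_integrable[OF has_integral_mult_right[OF scaled]])
    fix u assume u: "u \<in> {0..r}"
    have "p_fun d r \<le> p_fun d u * ((1 - u) / (1 - r)) ^ K"
      by (rule p_fun_ratio_upper[OF d]) (use u r in auto)
    also have "\<dots> \<le> p_fun d u * (1 + 4 * real j * (1 - u / r)) ^ K"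
    proof (intro mult_left_mono power_mono)
      have "(1 - u) / (1 - r) = 1 + r / (1 - r) * (1 - u / r)"
        using r by (simp add: field_simps)
      also have "\<dots> \<le> 1 + 4 * real j * (1 - u / r)"
        using r j u by (intro add_left_mono mult_right_mono order_trans[OF r(3)]) auto
      finally show "(1 - u) / (1 - r) \<le> 1 + 4 * real j * (1 - u / r)" .
    qed (use u r p_fun_pos[of d u] in auto)
    finally have "1 / p_fun d u \<le> (1 + 4 * real j * (1 - u / r)) ^ K / p_fun d r"
      using p_fun_pos[of d u] p_fun_pos[of d r] by (simp add: field_simps)
    then have "u ^ (j - 1) * (1 / p_fun d u) \<le> u ^ (j - 1) * ((1 + 4 * real j * (1 - u / r)) ^ K / p_fun d r)"
      using u by (intro mult_left_mono) auto
    then show "u ^ (j - 1) / p_fun d u \<le> r ^ (j - 1) / p_fun d r * f (u / r)"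
      using r by (simp add: f_def power_divide)
  qed
  also have "\<dots> = r ^ (j - 1) / p_fun d r * (r * integral {0..1} f)"
    by (intro integral_unique has_integral_mult_right scaled)
  also have "\<dots> = r ^ j / p_fun d r * integral {0..1} f"
    using j1 power_Suc[of r "j - 1"] by (simp add: mult_ac)
  also have "\<dots> \<le> r ^ j / p_fun d r * (kernel_const 0 4 K / real j ^ Suc 0)"
    unfolding f_def using r j1 p_fun_pos[of d r]
    by (intro mult_left_mono kernel_integral_bound) auto
  finally show ?thesis by (simp add: r_def mult_ac)
qed

lemma sum_kernel_integrand_upper:
  assumes d: "bounded_weights (real K) d" and j: "1 \<le> j" "j < n" and u: "0 \<le> u" "u \<le> 1" and c: "real n - real j \<le> c"
  shows "p_coeff (\<lambda>k. d k * (1 - u ^ k)) (n - j) \<le> 3 * real K * ((1 - u) * (1 + c * (1 - u)) ^ K)"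
proof -
  have "p_coeff (\<lambda>k. d k * (1 - u ^ k)) (n - j) \<le> 3 * real K * (1 - u) * (1 + real (n - j) * (1 - u)) ^ K"
    by (rule p_coeff_one_minus_upper[OF d u]) (use j in auto)
  also have "\<dots> \<le> 3 * real K * (1 - u) * (1 + c * (1 - u)) ^ K"
    using u j c by (intro mult_left_mono power_mono add_left_mono mult_right_mono) auto
  finally show ?thesis by (simp only: mult_ac)
qed

lemma sum_kernel_bound:
  assumes d: "bounded_weights (real K) d" and j: "1 \<le> j" "j < n" "n \<le> 4 * j"
  shows "0 \<le> sum_kernel d n j" "sum_kernel d n j \<le> 3 * real K * kernel_const 1 4 K / real j ^ 2"
proof -
  show "0 \<le> sum_kernel d n j"
    unfolding sum_kernel_def
    by (intro integral_nonneg integrable_continuous_interval continuous_intros continuous_on_p_coeff_one_minus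
        mult_nonneg_nonneg p_coeff_weights_nonneg[OF bounded_weights_one_minus[OF d]]) auto
  have "sum_kernel d n j \<le> integral {0..1} (\<lambda>u. 3 * real K * (u ^ (j - 1) * ((1 - u) ^ 1 * (1 + 4 * real j * (1 - u)) ^ K)))"
    unfolding sum_kernel_def
  proof (intro integral_le integrable_continuous_interval continuous_intros continuous_on_p_coeff_one_minus)
    fix u :: real assume u: "u \<in> {0..1}"
    have "u ^ (j - 1) * p_coeff (\<lambda>k. d k * (1 - u ^ k)) (n - j)
        \<le> u ^ (j - 1) * (3 * real K * ((1 - u) * (1 + 4 * real j * (1 - u)) ^ K))"
      using u j by (intro mult_left_mono sum_kernel_integrand_upper[OF d]) auto
    then show "u ^ (j - 1) * p_coeff (\<lambda>k. d k * (1 - u ^ k)) (n - j)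
        \<le> 3 * real K * (u ^ (j - 1) * ((1 - u) ^ 1 * (1 + 4 * real j * (1 - u)) ^ K))"
      by (simp add: mult_ac)
  qed
  also have "\<dots> = 3 * real K * integral {0..1} (\<lambda>u. u ^ (j - 1) * ((1 - u) ^ 1 * (1 + 4 * real j * (1 - u)) ^ K))"
    by simp
  also have "\<dots> \<le> 3 * real K * (kernel_const 1 4 K / real j ^ Suc 1)"
    using j by (intro mult_left_mono kernel_integral_bound) auto
  finally show "sum_kernel d n j \<le> 3 * real K * kernel_const 1 4 K / real j ^ 2"
    by (simp add: numeral_2_eq_2)
qed

text \<open>The relative error of \<open>coeff_quotient_approx\<close>, weighted with \<open>1 / p(u)\<close>, has no singularity at \<open>u = 1\<close>: beyond
\<open>rad j\<close> the growth of \<open>p\<close>, at least that of \<open>(1 - u) powr (- \<theta>)\<close>, compensates it. Below \<open>rad j\<close> the upper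
growth bound is used, and the resulting power is integrated against \<open>u ^ (j - 1)\<close> later on.\<close>
lemma weighted_inverse_p_fun_bound:
  assumes d: "bounded_weights (real K) d" and \<theta>: "\<And>k. k \<ge> 1 \<Longrightarrow> \<theta> \<le> d k" "0 \<le> \<theta>"
    and j: "j \<ge> 1" and n: "n \<ge> 1" and u: "0 \<le> u" "u < 1"
  defines "w \<equiv> max u (rad j)"
  shows "1 / p_fun d u * (1 / (real n * (1 - w))) powr \<theta>
    \<le> (2 * (real j / real n)) powr \<theta> / p_fun d (rad j) * (1 + 2 * real j * (1 - u)) ^ K"
proof -
  note rj = rad_pos[of j] rad_less_one[OF j] one_minus_rad_lower[OF j]
  have inv: "1 / (1 - rad j) \<le> 2 * real j"
    using rj j by (simp add: field_simps)
  have base: "1 / (real n * (1 - rad j)) \<le> 2 * (real j / real n)"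
    using divide_right_mono[OF inv, of "real n"] by (simp add: mult_ac)
  show ?thesis
  proof (cases "u \<le> rad j")
    case True
    have "p_fun d (rad j) \<le> p_fun d u * ((1 - u) / (1 - rad j)) ^ K"
      by (rule p_fun_ratio_upper[OF d]) (use True u rj in auto)
    also have "\<dots> \<le> p_fun d u * (1 + 2 * real j * (1 - u)) ^ K"
    proof (intro mult_left_mono power_mono)
      have "(1 - u) / (1 - rad j) = 1 / (1 - rad j) * (1 - u)" by simp
      also have "\<dots> \<le> 2 * real j * (1 - u)" using u by (intro mult_right_mono inv) auto
      finally show "(1 - u) / (1 - rad j) \<le> 1 + 2 * real j * (1 - u)" by simp
    qed (use u rj p_fun_pos[of d u] in auto)
    finally have "1 / p_fun d u \<le> (1 + 2 * real j * (1 - u)) ^ K / p_fun d (rad j)"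
      using p_fun_pos[of d u] p_fun_pos[of d "rad j"] by (simp add: field_simps)
    then have "1 / p_fun d u * (1 / (real n * (1 - w))) powr \<theta>
        \<le> (1 + 2 * real j * (1 - u)) ^ K / p_fun d (rad j) * (2 * (real j / real n)) powr \<theta>"
      using True base rj \<theta>(2) u p_fun_pos[of d "rad j"] n
      by (intro mult_mono powr_mono2) (auto simp: w_def max_absorb2)
    then show ?thesis by (simp add: mult_ac)
  next
    case False
    have w: "w = u" using False by (simp add: w_def)
    have "p_fun d (rad j) \<le> p_fun d u * ((1 - u) / (1 - rad j)) powr \<theta>"
      by (rule p_fun_ratio_lower[OF d \<theta>(1)]) (use False u rj in auto)
    then have "1 / p_fun d u \<le> ((1 - u) / (1 - rad j)) powr \<theta> / p_fun d (rad j)"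
      using p_fun_pos[of d u] p_fun_pos[of d "rad j"] by (simp add: field_simps)
    then have "1 / p_fun d u * (1 / (real n * (1 - w))) powr \<theta>
        \<le> ((1 - u) / (1 - rad j)) powr \<theta> / p_fun d (rad j) * (1 / (real n * (1 - u))) powr \<theta>"
      unfolding w by (rule mult_right_mono) simp
    also have "\<dots> = (((1 - u) / (1 - rad j)) * (1 / (real n * (1 - u)))) powr \<theta> / p_fun d (rad j)"
      using u rj by (subst powr_mult) auto
    also have "((1 - u) / (1 - rad j)) * (1 / (real n * (1 - u))) = 1 / (real n * (1 - rad j))"
      using u by simp
    also have "(1 / (real n * (1 - rad j))) powr \<theta> / p_fun d (rad j)
        \<le> (2 * (real j / real n)) powr \<theta> / p_fun d (rad j)"
      using base rj \<theta>(2) p_fun_pos[of d "rad j"] n by (intro divide_right_mono powr_mono2) auto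
    also have "\<dots> \<le> (2 * (real j / real n)) powr \<theta> / p_fun d (rad j) * (1 + 2 * real j * (1 - u)) ^ K"
    proof -
      have "1 \<le> (1 + 2 * real j * (1 - u)) ^ K" using u by (intro one_le_power) auto
      then show ?thesis
        using p_fun_pos[of d "rad j"] mult_left_mono[of 1 _ "(2 * (real j / real n)) powr \<theta> / p_fun d (rad j)"]
        by simp
    qed
    finally show ?thesis .
  qed
qed

text \<open>The left side is the weight of \<open>norm (S j)\<close> in the first sum of the estimate when \<open>P = p j\<close>; the right side is the
form in which it arises.\<close>
lemma error_weight_eq:
  assumes "1 \<le> j" "1 \<le> n"
  shows "1 / real n powr \<theta> * (1 / P * real j powr (\<theta> - 2)) = (real j / real n) powr \<theta> / (real j ^ 2 * P)"
  using assms by (simp add: powr_divide powr_diff powr_numeral field_simps)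

text \<open>Here \<open>\<kappa>\<close> stands for the constant of \<open>p_coeff_lower\<close>. The two summands come from the integrals over
\<open>{0..rad n}\<close> and \<open>{rad n..1}\<close>, and the factor \<open>3 * K\<close> from replacing \<open>p(rad j)\<close> by \<open>j * p j\<close>.\<close>
definition approx_const :: "nat \<Rightarrow> real \<Rightarrow> real" where
  "approx_const K \<kappa> = 3 * real K * \<kappa> *
    (2 * (2 ^ K * (24 * real K ^ 2 + 78 * real K + 18)) * kernel_const 0 2 K + 3 * real K * 2 ^ K)"

text \<open>On \<open>{0..rad n}\<close> the two integrands are close by \<open>coeff_quotient_approx\<close>. On \<open>{rad n..1}\<close>, an interval of
length at most \<open>1 / n\<close>, the integrand of the first kernel is itself of order \<open>1 / n\<close>.\<close>
lemma kernel_difference_small_index: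
  assumes d: "bounded_weights (real K) d" and \<theta>: "\<And>k. k \<ge> 1 \<Longrightarrow> \<theta> \<le> d k" "0 < \<theta>" "\<theta> \<le> 1"
    and K: "K \<ge> 1" and j: "1 \<le> j" "4 * j \<le> n"
  shows "\<bar>sum_kernel d n j / p_coeff d n - value_kernel d (rad n) j\<bar>
    \<le> approx_const K (2 * (2 * real K) ^ K / \<theta>) * (1 / real n powr \<theta> * (1 / p_coeff d j * real j powr (\<theta> - 2)))"
proof -
  have n: "n \<ge> 1" and jn: "j < n" using j by auto
  define \<kappa> where "\<kappa> = 2 * (2 * real K) ^ K / \<theta>"
  have \<kappa>0: "0 < \<kappa>" using K \<theta> by (simp add: \<kappa>_def)
  define C where "C = 2 ^ K * (24 * real K ^ 2 + 78 * real K + 18)"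
  have C0: "0 < C" by (simp add: C_def add_nonneg_pos)
  define r where "r = rad n"
  have r: "0 < r" "r < 1" "1 - r \<le> 1 / real n"
    using rad_pos rad_less_one[OF n] one_minus_rad_upper by (auto simp: r_def)
  have dpos: "d k > 0" if "k \<ge> 1" for k using \<theta>(1)[OF that] \<theta>(2) by simp
  have pn: "0 < p_coeff d n" and pj: "0 < p_coeff d j" using p_coeff_pos[of d] dpos by auto
  have low: "p_fun d r \<le> \<kappa> * (real n * p_coeff d n)"
    unfolding r_def \<kappa>_def by (rule p_coeff_lower[OF d \<theta>(1,2) K n])
  define f where "f = (\<lambda>u. p_coeff (\<lambda>k. d k * (1 - u ^ k)) (n - j))"
  define P where "P = p_fun d (rad j)"
  have P0: "0 < P" by (simp add: P_def p_fun_pos)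
  define E where "E = (real j / real n) powr \<theta> / (real j * P)"

  have point: "\<bar>f u / p_coeff d n - 1 / p_fun d u\<bar>
      \<le> C * \<kappa> * ((2 * (real j / real n)) powr \<theta> / P) * (1 + 2 * real j * (1 - u)) ^ K" if u: "u \<in> {0..r}" for u
  proof -
    let ?w = "max u (rad j)"
    have "real n * \<bar>f u - p_coeff d n / p_fun d u\<bar>
        \<le> C * (p_fun d r / p_fun d u) * (1 / (real n * (1 - ?w))) powr \<theta>"
      unfolding f_def C_def r_def
      by (rule coeff_quotient_approx[OF d \<theta>(1) less_imp_le[OF \<theta>(2)] \<theta>(3) j]) (use u in \<open>auto simp: r_def\<close>)
    also have "\<dots> = C * p_fun d r * (1 / p_fun d u * (1 / (real n * (1 - ?w))) powr \<theta>)" by simp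
    also have "\<dots> \<le> C * (\<kappa> * (real n * p_coeff d n)) *
        ((2 * (real j / real n)) powr \<theta> / P * (1 + 2 * real j * (1 - u)) ^ K)"
      unfolding P_def
      using u r C0 p_fun_pos[of d r] p_fun_pos[of d u] low n pn \<kappa>0
      by (intro mult_mono weighted_inverse_p_fun_bound[OF d \<theta>(1) less_imp_le[OF \<theta>(2)] j(1) n]) auto
    also have "\<dots> = real n * (p_coeff d n *
        (C * \<kappa> * ((2 * (real j / real n)) powr \<theta> / P) * (1 + 2 * real j * (1 - u)) ^ K))" by simp
    finally have "\<bar>f u - p_coeff d n / p_fun d u\<bar>
        \<le> p_coeff d n * (C * \<kappa> * ((2 * (real j / real n)) powr \<theta> / P) * (1 + 2 * real j * (1 - u)) ^ K)"
      using n by (simp only: mult_le_cancel_left_pos of_nat_0_less_iff)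
    moreover have "f u / p_coeff d n - 1 / p_fun d u = (f u - p_coeff d n / p_fun d u) / p_coeff d n"
      using pn p_fun_pos[of d u] by (simp add: field_simps)
    ultimately show ?thesis using pn by (simp add: abs_divide pos_divide_le_eq mult_ac)
  qed

  have cont_f: "continuous_on S f" for S
    unfolding f_def by (rule continuous_on_p_coeff_one_minus)
  have int_f: "(\<lambda>u. u ^ (j - 1) * f u) integrable_on {a..b}" for a b
    by (intro integrable_continuous_interval continuous_intros cont_f)
  have int_p: "(\<lambda>u. u ^ (j - 1) / p_fun d u) integrable_on {0..r}"
    by (intro integrable_continuous_interval continuous_on_inverse_p_fun[OF d r(2)])
  have inner: "\<bar>integral {0..r} (\<lambda>u. u ^ (j - 1) * f u / p_coeff d n - u ^ (j - 1) / p_fun d u)\<bar>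
      \<le> 2 * C * \<kappa> * kernel_const 0 2 K * E"
  proof -
    define c where "c = C * \<kappa> * ((2 * (real j / real n)) powr \<theta> / P)"
    have c0: "0 \<le> c" using C0 \<kappa>0 P0 by (simp add: c_def)
    define b where "b = (\<lambda>u::real. c * (u ^ (j - 1) * ((1 - u) ^ 0 * (1 + 2 * real j * (1 - u)) ^ K)))"
    have int_b: "b integrable_on {x..y}" for x y
      unfolding b_def by (intro integrable_continuous_interval continuous_intros)
    have "norm (integral {0..r} (\<lambda>u. u ^ (j - 1) * f u / p_coeff d n - u ^ (j - 1) / p_fun d u)) \<le> integral {0..r} b"
    proof (rule integral_norm_bound_integral[OF _ int_b])
      show "(\<lambda>u. u ^ (j - 1) * f u / p_coeff d n - u ^ (j - 1) / p_fun d u) integrable_on {0..r}"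
        by (intro integrable_diff integrable_on_divide int_f int_p)
      fix u assume u: "u \<in> {0..r}"
      have "u ^ (j - 1) * f u / p_coeff d n - u ^ (j - 1) / p_fun d u = u ^ (j - 1) * (f u / p_coeff d n - 1 / p_fun d u)"
        by (simp add: right_diff_distrib)
      then have "norm (u ^ (j - 1) * f u / p_coeff d n - u ^ (j - 1) / p_fun d u)
          = u ^ (j - 1) * \<bar>f u / p_coeff d n - 1 / p_fun d u\<bar>"
        using u by (simp add: abs_mult)
      also have "\<dots> \<le> u ^ (j - 1) * (c * (1 + 2 * real j * (1 - u)) ^ K)"
        unfolding c_def using u by (intro mult_left_mono point) auto
      finally show "norm (u ^ (j - 1) * f u / p_coeff d n - u ^ (j - 1) / p_fun d u) \<le> b u"
        by (simp add: b_def mult_ac)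
    qed
    also have "integral {0..r} b \<le> integral {0..1} b"
      by (rule integral_subset_le[OF _ int_b int_b]) (use r c0 in \<open>auto simp: b_def\<close>)
    also have "\<dots> = c * integral {0..1} (\<lambda>u::real. u ^ (j - 1) * ((1 - u) ^ 0 * (1 + 2 * real j * (1 - u)) ^ K))"
      unfolding b_def by simp
    also have "\<dots> \<le> c * (kernel_const 0 2 K / real j ^ Suc 0)"
      using j c0 by (intro mult_left_mono kernel_integral_bound) auto
    also have "\<dots> \<le> (C * \<kappa> * (2 * (real j / real n) powr \<theta> / P)) * (kernel_const 0 2 K / real j ^ Suc 0)"
    proof (intro mult_right_mono)
      have "2 powr \<theta> \<le> (2::real) powr 1" using \<theta> by (intro powr_mono) auto
      then have "2 powr \<theta> * (real j / real n) powr \<theta> \<le> 2 * (real j / real n) powr \<theta>"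
        by (intro mult_right_mono) auto
      then have "(2 * (real j / real n)) powr \<theta> \<le> 2 * (real j / real n) powr \<theta>"
        by (simp only: powr_mult)
      then show "c \<le> C * \<kappa> * (2 * (real j / real n) powr \<theta> / P)"
        unfolding c_def using C0 \<kappa>0 P0 by (intro mult_left_mono divide_right_mono) auto
    qed (use kernel_const_pos[of 2 0 K] in auto)
    finally show ?thesis by (simp add: E_def mult_ac)
  qed

  have outer: "integral {r..1} (\<lambda>u. u ^ (j - 1) * f u) / p_coeff d n \<le> 3 * real K * 2 ^ K * \<kappa> * E"
    and outer0: "0 \<le> integral {r..1} (\<lambda>u. u ^ (j - 1) * f u) / p_coeff d n"
  proof -
    define c where "c = 3 * real K * (1 / real n * 2 ^ K)"
    have "integral {r..1} (\<lambda>u. u ^ (j - 1) * f u) \<le> integral {r..1} (\<lambda>u. c)"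
    proof (intro integral_le int_f integrable_continuous_interval continuous_on_const)
      fix u assume u: "u \<in> {r..1}"
      have u1: "1 - u \<le> 1 / real n"
        using u r by auto
      then have u2: "real n * (1 - u) \<le> 1"
        using n by (simp add: field_simps)
      have "f u \<le> 3 * real K * ((1 - u) * (1 + real n * (1 - u)) ^ K)"
        unfolding f_def by (rule sum_kernel_integrand_upper[OF d j(1) jn]) (use u r in auto)
      also have "\<dots> \<le> c"
        unfolding c_def using u u1 u2 by (intro mult_left_mono mult_mono power_mono) auto
      finally have "f u \<le> c" .
      then have "u ^ (j - 1) * f u \<le> 1 * c"
        using u r p_coeff_weights_nonneg[OF bounded_weights_one_minus[OF d]]
        by (intro mult_mono) (auto simp: f_def power_le_one)
      then show "u ^ (j - 1) * f u \<le> c" by simp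
    qed
    also have "\<dots> = c * (1 - r)" using r by simp
    also have "\<dots> \<le> c * (1 / real n)" using r by (intro mult_left_mono) (auto simp: c_def)
    finally have "integral {r..1} (\<lambda>u. u ^ (j - 1) * f u) / p_coeff d n \<le> c * (1 / real n) / p_coeff d n"
      using pn by (intro divide_right_mono) auto
    also have "\<dots> = 3 * real K * 2 ^ K * (1 / real n) * (1 / (real n * p_coeff d n))" by (simp add: c_def)
    also have "\<dots> \<le> 3 * real K * 2 ^ K * ((real j / real n) powr \<theta> / real j) * (\<kappa> / P)"
    proof (intro mult_mono)
      have "(real j / real n) powr 1 \<le> (real j / real n) powr \<theta>"
        using j jn \<theta> by (intro powr_mono') auto
      then have "real j / real n / real j \<le> (real j / real n) powr \<theta> / real j"
        by (intro divide_right_mono) auto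
      then show "1 / real n \<le> (real j / real n) powr \<theta> / real j" using j by simp
      have "P \<le> p_fun d r"
        unfolding P_def r_def using rad_pos[of j] rad_mono[of j n] j rad_less_one[OF n]
        by (intro p_fun_mono[OF d]) auto
      then show "1 / (real n * p_coeff d n) \<le> \<kappa> / P"
        using low P0 n pn by (simp add: field_simps)
    qed (use n pn in auto)
    finally show "integral {r..1} (\<lambda>u. u ^ (j - 1) * f u) / p_coeff d n \<le> 3 * real K * 2 ^ K * \<kappa> * E"
      by (simp add: E_def mult_ac)
    have "0 \<le> integral {r..1} (\<lambda>u. u ^ (j - 1) * f u)"
      using r p_coeff_weights_nonneg[OF bounded_weights_one_minus[OF d]]
      by (intro integral_nonneg int_f) (auto simp: f_def)
    then show "0 \<le> integral {r..1} (\<lambda>u. u ^ (j - 1) * f u) / p_coeff d n" using pn by simp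
  qed

  have split: "sum_kernel d n j / p_coeff d n - value_kernel d r j
      = integral {0..r} (\<lambda>u. u ^ (j - 1) * f u / p_coeff d n - u ^ (j - 1) / p_fun d u)
        + integral {r..1} (\<lambda>u. u ^ (j - 1) * f u) / p_coeff d n"
  proof -
    have "sum_kernel d n j = integral {0..r} (\<lambda>u. u ^ (j - 1) * f u) + integral {r..1} (\<lambda>u. u ^ (j - 1) * f u)"
      unfolding sum_kernel_def f_def[symmetric]
      using Henstock_Kurzweil_Integration.integral_combine[of 0 r 1, OF _ _ int_f] r by (simp add: f_def)
    moreover have "integral {0..r} (\<lambda>u. u ^ (j - 1) * f u / p_coeff d n - u ^ (j - 1) / p_fun d u)
        = integral {0..r} (\<lambda>u. u ^ (j - 1) * f u) / p_coeff d n - value_kernel d r j"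
      unfolding value_kernel_def
      by (subst integral_diff[OF integrable_on_divide[OF int_f] int_p]) simp
    ultimately show ?thesis by (simp add: add_divide_distrib)
  qed
  have "\<bar>sum_kernel d n j / p_coeff d n - value_kernel d r j\<bar>
      \<le> 2 * C * \<kappa> * kernel_const 0 2 K * E + 3 * real K * 2 ^ K * \<kappa> * E"
    unfolding split using inner outer outer0 by linarith
  also have "\<dots> = (2 * C * kernel_const 0 2 K + 3 * real K * 2 ^ K) * \<kappa> * E"
    by (simp add: algebra_simps)
  also have "\<dots> \<le> (2 * C * kernel_const 0 2 K + 3 * real K * 2 ^ K) * \<kappa>
      * (3 * real K * ((real j / real n) powr \<theta> / (real j ^ 2 * p_coeff d j)))"
  proof (intro mult_left_mono)
    have "real j * p_coeff d j \<le> 3 * real K * P"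
      unfolding P_def by (rule p_coeff_upper[OF d j(1)])
    then have "1 / P \<le> 3 * real K * (1 / (real j * p_coeff d j))"
      using P0 pj j by (simp add: field_simps)
    then have "(real j / real n) powr \<theta> / real j * (1 / P)
        \<le> (real j / real n) powr \<theta> / real j * (3 * real K * (1 / (real j * p_coeff d j)))"
      by (intro mult_left_mono) auto
    then show "E \<le> 3 * real K * ((real j / real n) powr \<theta> / (real j ^ 2 * p_coeff d j))"
      by (simp add: E_def power2_eq_square mult_ac)
  qed (use C0 \<kappa>0 kernel_const_pos[of 2 0 K] in auto)
  finally show ?thesis
    unfolding error_weight_eq[OF j(1) n] by (simp add: r_def approx_const_def C_def \<kappa>_def mult_ac)
qed

text \<open>For indices comparable to \<open>n\<close> the factor \<open>(j / n) powr \<theta>\<close> is bounded below, so nothing has to be gained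
from cancellation between the kernels.\<close>
lemma quarter_le_powr:
  assumes \<theta>: "0 \<le> \<theta>" "\<theta> \<le> 1" and j: "1 \<le> j" "j \<le> n" "n \<le> 4 * j"
  shows "1 \<le> 4 * (real j / real n) powr \<theta>"
proof -
  have "(real j / real n) powr 1 \<le> (real j / real n) powr \<theta>"
    using \<theta> j by (intro powr_mono') auto
  then have "real j / real n \<le> (real j / real n) powr \<theta>" by simp
  moreover have "1 \<le> 4 * (real j / real n)" using j by (simp add: field_simps)
  ultimately show ?thesis by linarith
qed

lemma inverse_p_fun_le:
  assumes d: "bounded_weights (real K) d" and pos: "\<And>k. k \<ge> 1 \<Longrightarrow> 0 < d k" and j: "1 \<le> j" "j \<le> n"
  shows "1 / p_fun d (rad n) \<le> 3 * real K / (real j * p_coeff d j)"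
proof -
  have pj: "0 < p_coeff d j" by (rule p_coeff_pos) (rule pos)
  have "real j * p_coeff d j \<le> 3 * real K * p_fun d (rad j)"
    by (rule p_coeff_upper[OF d j(1)])
  also have "\<dots> \<le> 3 * real K * p_fun d (rad n)"
    using rad_pos[of j] rad_mono[OF j] rad_less_one[of n] j
    by (intro mult_left_mono p_fun_mono[OF d]) auto
  finally show ?thesis
    using pj j p_fun_pos[of d "rad n"] by (simp add: field_simps)
qed

lemma value_kernel_large_index:
  assumes d: "bounded_weights (real K) d" and pos: "\<And>k. k \<ge> 1 \<Longrightarrow> 0 < d k"
    and \<theta>: "0 \<le> \<theta>" "\<theta> \<le> 1" and j: "1 \<le> j" "j \<le> n" "n \<le> 4 * j"
  shows "value_kernel d (rad n) j
    \<le> 12 * real K * kernel_const 0 4 K * (1 / real n powr \<theta> * (1 / p_coeff d j * real j powr (\<theta> - 2)))"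
proof -
  have n: "n \<ge> 1" using j by simp
  have pj: "0 < p_coeff d j" by (rule p_coeff_pos) (rule pos)
  note kc = kernel_const_pos[of 4 0 K]
  have "value_kernel d (rad n) j \<le> kernel_const 0 4 K * (rad n ^ j / (real j * p_fun d (rad n)))"
    by (rule value_kernel_bound[OF d n j(3)])
  also have "\<dots> = kernel_const 0 4 K * (rad n ^ j * (1 / real j) * (1 / p_fun d (rad n)))" by simp
  also have "\<dots> \<le> kernel_const 0 4 K * (1 * (1 / real j) * (3 * real K / (real j * p_coeff d j)))"
    using j kc rad_pos[of n] rad_less_one[OF n] p_fun_pos[of d "rad n"]
    by (intro mult_left_mono mult_mono inverse_p_fun_le[OF d pos]) (auto simp: power_le_one)
  also have "\<dots> = 3 * real K * kernel_const 0 4 K * (1 / (real j ^ 2 * p_coeff d j)) * 1"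
    by (simp add: power2_eq_square mult_ac)
  also have "\<dots> \<le> 3 * real K * kernel_const 0 4 K * (1 / (real j ^ 2 * p_coeff d j)) * (4 * (real j / real n) powr \<theta>)"
    using kc pj by (intro mult_left_mono quarter_le_powr \<theta> j) auto
  finally show ?thesis unfolding error_weight_eq[OF j(1) n] by (simp add: mult_ac)
qed

lemma kernel_difference_large_index:
  assumes d: "bounded_weights (real K) d" and \<theta>: "\<And>k. k \<ge> 1 \<Longrightarrow> \<theta> \<le> d k" "0 < \<theta>" "\<theta> \<le> 1"
    and K: "K \<ge> 1" and j: "1 \<le> j" "j < n" "n \<le> 4 * j"
  shows "\<bar>sum_kernel d n j / p_coeff d n - value_kernel d (rad n) j\<bar>
    \<le> (144 * real K ^ 2 * (2 * (2 * real K) ^ K / \<theta>) * kernel_const 1 4 K + 12 * real K * kernel_const 0 4 K)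
        * (1 / real n powr \<theta> * (1 / p_coeff d j * real j powr (\<theta> - 2)))"
proof -
  have n: "n \<ge> 1" using j by simp
  define \<kappa> where "\<kappa> = 2 * (2 * real K) ^ K / \<theta>"
  have \<kappa>0: "0 < \<kappa>" using K \<theta> by (simp add: \<kappa>_def)
  have pos: "0 < d k" if "k \<ge> 1" for k using \<theta>(1)[OF that] \<theta>(2) by simp
  have pn: "0 < p_coeff d n" and pj: "0 < p_coeff d j" using p_coeff_pos[of d] pos by auto
  note kc = kernel_const_pos[of 4 1 K]
  have "p_fun d (rad n) \<le> \<kappa> * (real n * p_coeff d n)"
    unfolding \<kappa>_def by (rule p_coeff_lower[OF d \<theta>(1,2) K n])
  then have "1 / p_coeff d n \<le> \<kappa> * real n * (1 / p_fun d (rad n))"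
    using pn p_fun_pos[of d "rad n"] by (simp add: field_simps)
  also have "\<dots> \<le> \<kappa> * (4 * real j) * (3 * real K / (real j * p_coeff d j))"
    using \<kappa>0 j p_fun_pos[of d "rad n"]
    by (intro mult_mono inverse_p_fun_le[OF d pos]) auto
  also have "\<dots> = 12 * real K * \<kappa> / p_coeff d j" using j by simp
  finally have inv: "1 / p_coeff d n \<le> 12 * real K * \<kappa> / p_coeff d j" .
  have "sum_kernel d n j / p_coeff d n = sum_kernel d n j * (1 / p_coeff d n)" by simp
  also have "\<dots> \<le> (3 * real K * kernel_const 1 4 K / real j ^ 2) * (12 * real K * \<kappa> / p_coeff d j)"
    using kc pn by (intro mult_mono inv sum_kernel_bound[OF d j]) auto
  also have "\<dots> = 36 * real K ^ 2 * \<kappa> * kernel_const 1 4 K * (1 / (real j ^ 2 * p_coeff d j)) * 1"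
    by (simp add: power2_eq_square mult_ac)
  also have "\<dots> \<le> 36 * real K ^ 2 * \<kappa> * kernel_const 1 4 K * (1 / (real j ^ 2 * p_coeff d j))
      * (4 * (real j / real n) powr \<theta>)"
    using kc pj \<kappa>0 \<theta> j by (intro mult_left_mono quarter_le_powr) auto
  also have "\<dots> = 144 * real K ^ 2 * \<kappa> * kernel_const 1 4 K
      * (1 / real n powr \<theta> * (1 / p_coeff d j * real j powr (\<theta> - 2)))"
    unfolding error_weight_eq[OF j(1) n] by simp
  finally have s: "sum_kernel d n j / p_coeff d n \<le> \<dots>" .
  have v: "value_kernel d (rad n) j
      \<le> 12 * real K * kernel_const 0 4 K * (1 / real n powr \<theta> * (1 / p_coeff d j * real j powr (\<theta> - 2)))"
    by (rule value_kernel_large_index[OF d pos]) (use \<theta> j in auto)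
  have "0 \<le> sum_kernel d n j / p_coeff d n" using sum_kernel_bound(1)[OF d j] pn by simp
  moreover have "0 \<le> value_kernel d (rad n) j" by (rule value_kernel_nonneg[OF d rad_less_one[OF n]])
  ultimately show ?thesis
    using s v unfolding \<kappa>_def[symmetric] distrib_right by linarith
qed

section \<open>Expansions in terms of S\<close>

text \<open>Dividing \<open>z g'(z) p(z)\<close> by \<open>p(z)\<close>.\<close>

lemma coeff_from_S_sum:
  "of_nat k * a k = (\<Sum>j=0..k. S_sum d a j * of_real (p_coeff (\<lambda>k. - d k) (k - j)))"
proof -
  define A :: "complex fps" where "A = Abs_fps (\<lambda>k. a k * of_nat k)"
  define P :: "complex fps" where "P = Abs_fps (\<lambda>k. of_real (p_coeff d k))"
  define Q :: "complex fps" where "Q = Abs_fps (\<lambda>k. of_real (p_coeff (\<lambda>k. - d k) k))"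
  have "P * Q = 1"
  proof (rule fps_ext)
    fix m
    have "(\<Sum>i=0..m. p_coeff d i * p_coeff (\<lambda>k. - d k) (m - i)) = (if m = 0 then 1 else 0)"
      using p_coeff_add[of d "\<lambda>k. - d k" m] by (simp add: p_coeff_zero)
    then have "of_real (\<Sum>i=0..m. p_coeff d i * p_coeff (\<lambda>k. - d k) (m - i)) = (if m = 0 then 1 else (0 :: complex))"
      by simp
    then show "fps_nth (P * Q) m = fps_nth 1 m"
      by (simp add: fps_mult_nth P_def Q_def)
  qed
  then have "fps_nth A k = fps_nth ((A * P) * Q) k" by (simp add: mult.assoc)
  moreover have "fps_nth (A * P) j = S_sum d a j" for j
    by (simp add: fps_mult_nth A_def P_def S_sum_def)
  ultimately have "fps_nth A k = (\<Sum>j=0..k. S_sum d a j * of_real (p_coeff (\<lambda>k. - d k) (k - j)))"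
    by (simp add: fps_mult_nth[of "A * P"] Q_def)
  then show ?thesis by (simp add: A_def mult.commute)
qed

lemma sum_kernel_expand:
  assumes j: "1 \<le> j" "j \<le> n"
  shows "sum_kernel d n j = (\<Sum>k=j..n. p_coeff d (n - k) * p_coeff (\<lambda>k. - d k) (k - j) / real k)"
proof -
  let ?q = "p_coeff (\<lambda>k. - d k)"
  have monom: "((\<lambda>u::real. u ^ (k - 1)) has_integral (1 / real k)) {0..1}" if k: "k \<ge> 1" for k
  proof -
    have "((\<lambda>u::real. u ^ (k - 1)) has_integral (1 ^ k / real k - 0 ^ k / real k)) {0..1}"
    proof (rule fundamental_theorem_of_calculus)
      fix x :: real
      have "((\<lambda>u. u ^ k / real k) has_real_derivative (real k * x ^ (k - Suc 0) / real k)) (at x within {0..1})"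
        by (intro DERIV_cdivide DERIV_pow)
      then show "((\<lambda>u. u ^ k / real k) has_vector_derivative x ^ (k - 1)) (at x within {0..1})"
        using k by (simp add: has_real_derivative_iff_has_vector_derivative)
    qed simp
    then show ?thesis using k by (auto simp: zero_power)
  qed
  have "u ^ (j - 1) * p_coeff (\<lambda>k. d k * (1 - u ^ k)) (n - j)
      = (\<Sum>k=j..n. p_coeff d (n - k) * ?q (k - j) * u ^ (k - 1))" for u :: real
  proof -
    have "u ^ (j - 1) * p_coeff (\<lambda>k. d k * (1 - u ^ k)) (n - j)
        = (\<Sum>i=0..n - j. p_coeff d i * ?q (n - j - i) * u ^ (n - i - 1))"
      unfolding p_coeff_one_minus_expand sum_distrib_left
    proof (rule sum.cong)
      fix i assume "i \<in> {0..n - j}"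
      then have "u ^ (n - i - 1) = u ^ (j - 1) * u ^ (n - j - i)"
        using j by (simp flip: power_add)
      then show "u ^ (j - 1) * (p_coeff d i * (?q (n - j - i) * u ^ (n - j - i)))
          = p_coeff d i * ?q (n - j - i) * u ^ (n - i - 1)" by (simp add: mult_ac)
    qed simp
    also have "\<dots> = (\<Sum>k=j..n. p_coeff d (n - k) * ?q (k - j) * u ^ (k - 1))"
      by (rule sum.reindex_bij_witness[of _ "\<lambda>k. n - k" "\<lambda>k. n - k"]) (use j in \<open>auto simp: add.commute\<close>)
    finally show ?thesis .
  qed
  then have "sum_kernel d n j = integral {0..1} (\<lambda>u. \<Sum>k=j..n. p_coeff d (n - k) * ?q (k - j) * u ^ (k - 1))"
    by (simp add: sum_kernel_def)
  also have "\<dots> = (\<Sum>k=j..n. p_coeff d (n - k) * ?q (k - j) * (1 / real k))"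
    by (intro integral_unique has_integral_sum has_integral_mult_right monom) (use j in auto)
  finally show ?thesis by simp
qed

text \<open>The factor \<open>1 / k\<close> that recovers \<open>a k\<close> from \<open>k * a k\<close> is the integral of \<open>u ^ (k - 1)\<close>; it turns the double
sum into the kernel.\<close>
lemma weighted_mean_expand:
  "(\<Sum>k=0..n. a k * of_real (p_coeff d (n - k)))
    = a 0 * of_real (p_coeff d n) + (\<Sum>j=1..n. S_sum d a j * of_real (sum_kernel d n j))"
proof -
  let ?q = "p_coeff (\<lambda>k. - d k)"
  have S0: "S_sum d a 0 = 0" by (simp add: S_sum_def)
  define T where "T = (\<lambda>k j. S_sum d a j * of_real (p_coeff d (n - k) * ?q (k - j) / real k))"
  have "(\<Sum>k=0..n. a k * of_real (p_coeff d (n - k)))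
      = a 0 * of_real (p_coeff d n) + (\<Sum>k=1..n. a k * of_real (p_coeff d (n - k)))"
    by (simp add: sum.atLeast_Suc_atMost)
  also have "(\<Sum>k=1..n. a k * of_real (p_coeff d (n - k))) = (\<Sum>k=1..n. \<Sum>j=1..n. if j \<le> k then T k j else 0)"
  proof (rule sum.cong)
    fix k assume k: "k \<in> {1..n}"
    then have "a k = (of_nat k * a k) / of_nat k" by simp
    also have "of_nat k * a k = (\<Sum>j=1..k. S_sum d a j * of_real (?q (k - j)))"
      unfolding coeff_from_S_sum[of k a d] by (simp add: sum.atLeast_Suc_atMost S0)
    finally have "a k * of_real (p_coeff d (n - k))
        = (\<Sum>j=1..k. S_sum d a j * of_real (?q (k - j))) / of_nat k * of_real (p_coeff d (n - k))"
      by (rule arg_cong)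
    also have "\<dots> = (\<Sum>j=1..k. T k j)"
      unfolding T_def sum_divide_distrib sum_distrib_right by (intro sum.cong) simp_all
    also have "\<dots> = (\<Sum>j=1..n. if j \<le> k then T k j else 0)"
      using k by (intro sum.mono_neutral_cong_left) auto
    finally show "a k * of_real (p_coeff d (n - k)) = (\<Sum>j=1..n. if j \<le> k then T k j else 0)" .
  qed simp
  also have "\<dots> = (\<Sum>j=1..n. \<Sum>k=1..n. if j \<le> k then T k j else 0)" by (rule sum.swap)
  also have "\<dots> = (\<Sum>j=1..n. S_sum d a j * of_real (sum_kernel d n j))"
  proof (rule sum.cong)
    fix j assume j: "j \<in> {1..n}"
    have "(\<Sum>k=1..n. if j \<le> k then T k j else 0) = (\<Sum>k=j..n. T k j)"
      using j by (intro sum.mono_neutral_cong_right) auto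
    also have "\<dots> = S_sum d a j * of_real (sum_kernel d n j)"
      using j by (simp add: T_def sum_kernel_expand sum_distrib_left)
    finally show "(\<Sum>k=1..n. if j \<le> k then T k j else 0) = S_sum d a j * of_real (sum_kernel d n j)" .
  qed simp
  finally show ?thesis .
qed

lemma S_sum_Suc:
  "S_sum d a (Suc j) = (\<Sum>k\<le>j. diffs a k * of_real (p_coeff d (j - k)))"
proof -
  have "S_sum d a (Suc j) = (\<Sum>k=Suc 0..Suc j. a k * of_nat k * of_real (p_coeff d (Suc j - k)))"
    unfolding S_sum_def by (subst sum.atLeast_Suc_atMost) auto
  also have "\<dots> = (\<Sum>k=0..j. a (Suc k) * of_nat (Suc k) * of_real (p_coeff d (Suc j - Suc k)))"
    by (rule sum.shift_bounds_cl_Suc_ivl)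
  finally show ?thesis by (simp add: diffs_def atMost_atLeast0 mult_ac del: of_nat_Suc)
qed

text \<open>Termwise integration of \<open>g'(u) = (\<Sum>i. S (i + 1) * u ^ i) / p(u)\<close> over \<open>{0..r}\<close>; the convergence is uniform there
because \<open>p(u) \<ge> 1\<close> and the series of \<open>S\<close> converges absolutely at \<open>r\<close>.\<close>
lemma value_expand:
  fixes g :: "complex \<Rightarrow> complex"
  assumes d: "bounded_weights D d"
    and g: "g analytic_on ball 0 1" and a: "\<And>z. norm z < 1 \<Longrightarrow> (\<lambda>n. a n * z ^ n) sums g z"
    and r: "0 < r" "r < 1"
  shows "(\<lambda>N. \<Sum>i<N. S_sum d a (Suc i) * of_real (value_kernel d r (Suc i))) \<longlonglongrightarrow> g (of_real r) - a 0"
proof -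
  have g_deriv: "(g has_field_derivative deriv g z) (at z)" if "norm z < 1" for z
    using g that by (intro analytic_derivI[OF analytic_on_subset[of g "ball 0 1"]]) auto
  have deriv_sums: "(\<lambda>n. diffs a n * z ^ n) sums deriv g z" if "norm z < 1" for z
    by (rule termdiffs_sums_strong[OF a g_deriv[OF that] that])
  have p_sums: "(\<lambda>k. p_coeff d k * u ^ k) sums p_fun d u" if "0 \<le> u" "u < 1" for u
    by (rule p_coeff_weights_sums[OF d]) (use that in auto)
  have abs_diffs: "summable (\<lambda>k. norm (diffs a k * of_real u ^ k))" if u: "0 \<le> u" "u < 1" for u :: real
  proof (rule powser_insidea)
    show "summable (\<lambda>n. diffs a n * of_real ((1 + u) / 2) ^ n)"
      by (rule sums_summable[OF deriv_sums]) (use u in \<open>simp only: norm_of_real, simp\<close>)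
    show "norm (of_real u :: complex) < norm (of_real ((1 + u) / 2) :: complex)"
      using u by (simp only: norm_of_real, simp)
  qed
  have abs_p: "summable (\<lambda>k. norm (of_real (p_coeff d k * u ^ k) :: complex))" if u: "0 \<le> u" "u < 1" for u
    using p_sums[OF u] p_coeff_weights_nonneg[OF d] u
    by (simp add: sums_iff abs_mult del: of_real_mult of_real_power)
  have coeff: "(\<Sum>k\<le>j. (diffs a k * of_real u ^ k) * of_real (p_coeff d (j - k) * u ^ (j - k)))
      = S_sum d a (Suc j) * of_real (u ^ j)" for u :: real and j
    unfolding S_sum_Suc sum_distrib_right
  proof (rule sum.cong)
    fix k assume "k \<in> {..j}"
    then have "u ^ j = u ^ k * u ^ (j - k)" by (simp flip: power_add)
    then show "(diffs a k * of_real u ^ k) * of_real (p_coeff d (j - k) * u ^ (j - k))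
        = diffs a k * of_real (p_coeff d (j - k)) * of_real (u ^ j)" by (simp add: mult_ac)
  qed simp
  have S_sums: "(\<lambda>j. S_sum d a (Suc j) * of_real (u ^ j)) sums (deriv g (of_real u) * of_real (p_fun d u))"
    if u: "0 \<le> u" "u < 1" for u :: real
  proof -
    have "(\<lambda>k. of_real (p_coeff d k * u ^ k) :: complex) sums of_real (p_fun d u)"
      using p_sums[OF u] by (simp only: sums_of_real_iff)
    then show ?thesis
      using Cauchy_product_sums[OF abs_diffs[OF u] abs_p[OF u]] deriv_sums[of "of_real u"] u
      unfolding coeff by (simp add: sums_iff)
  qed
  have S_abs: "summable (\<lambda>j. norm (S_sum d a (Suc j)) * r ^ j)"
  proof (rule summable_comparison_test'[of _ 0])
    show "summable (\<lambda>j. \<Sum>k\<le>j. norm (diffs a k * of_real r ^ k) * norm (of_real (p_coeff d (j - k) * r ^ (j - k)) :: complex))"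
      by (intro summable_Cauchy_product) (use abs_diffs[of r] abs_p[of r] r in auto)
    fix j :: nat
    have "norm (S_sum d a (Suc j)) * r ^ j = norm (S_sum d a (Suc j) * of_real (r ^ j))"
      using r by (simp add: norm_mult norm_power)
    also have "\<dots> \<le> (\<Sum>k\<le>j. norm ((diffs a k * of_real r ^ k) * (of_real (p_coeff d (j - k) * r ^ (j - k)) :: complex)))"
      unfolding coeff[symmetric] by (rule norm_sum)
    also have "\<dots> = (\<Sum>k\<le>j. norm (diffs a k * of_real r ^ k) * norm (of_real (p_coeff d (j - k) * r ^ (j - k)) :: complex))"
      by (simp only: norm_mult)
    finally show "norm (norm (S_sum d a (Suc j)) * r ^ j)
        \<le> (\<Sum>k\<le>j. norm (diffs a k * of_real r ^ k) * norm (of_real (p_coeff d (j - k) * r ^ (j - k)) :: complex))"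
      using r by simp
  qed
  define f where "f = (\<lambda>i u. S_sum d a (Suc i) * of_real (u ^ i / p_fun d u))"
  have f_int: "(f i has_integral (S_sum d a (Suc i) * of_real (value_kernel d r (Suc i)))) {0..r}" for i
  proof -
    have "((\<lambda>u. u ^ i / p_fun d u) has_integral value_kernel d r (Suc i)) {0..r}"
      unfolding value_kernel_def diff_Suc_1
      by (intro integrable_integral integrable_continuous_interval continuous_on_inverse_p_fun[OF d r(2)])
    then show ?thesis
      unfolding f_def by (intro has_integral_mult_right has_integral_of_real)
  qed
  have f_suminf: "(\<Sum>i. f i u) = deriv g (of_real u)" if u: "u \<in> {0..r}" for u
  proof -
    have "(\<lambda>j. S_sum d a (Suc j) * of_real (u ^ j) / of_real (p_fun d u))
        sums (deriv g (of_real u) * of_real (p_fun d u) / of_real (p_fun d u))"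
      by (intro sums_divide S_sums) (use u r in auto)
    then show ?thesis
      using p_fun_pos[of d u] by (simp add: f_def sums_iff)
  qed
  have f_bound: "norm (f i u) \<le> norm (S_sum d a (Suc i)) * r ^ i" if u: "u \<in> {0..r}" for i u
  proof -
    have "u ^ i / p_fun d u \<le> r ^ i / 1"
      using u r p_fun_ge_one[OF d, of u] by (intro frac_le power_mono) auto
    moreover have "norm (f i u) = norm (S_sum d a (Suc i)) * (u ^ i / p_fun d u)"
      using u p_fun_pos[of d u] by (simp add: f_def norm_mult norm_divide norm_power)
    ultimately show ?thesis
      using mult_left_mono[of "u ^ i / p_fun d u" "r ^ i" "norm (S_sum d a (Suc i))"] by simp
  qed
  have unif: "uniform_limit {0..r} (\<lambda>N u. \<Sum>i<N. f i u) (\<lambda>u. \<Sum>i. f i u) sequentially"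
    by (rule Weierstrass_m_test[OF f_bound S_abs])
  have cont: "continuous_on {0..r} (\<lambda>u. \<Sum>i<N. f i u)" for N
    unfolding f_def
    by (intro continuous_intros continuous_on_inverse_p_fun[OF d r(2)])
  obtain I J where I: "\<And>N. ((\<lambda>u. \<Sum>i<N. f i u) has_integral I N) {0..r}"
    and J: "((\<lambda>u. \<Sum>i. f i u) has_integral J) {0..r}" and lim: "I \<longlonglongrightarrow> J"
    using uniform_limit_integral[OF unif cont sequentially_bot] by blast
  have I_eq: "I N = (\<Sum>i<N. S_sum d a (Suc i) * of_real (value_kernel d r (Suc i)))" for N
    by (rule has_integral_unique[OF I]) (intro has_integral_sum f_int, auto)
  have J_eq: "J = g (of_real r) - a 0"
  proof (rule has_integral_unique[OF J])
    have "((\<lambda>u. deriv g (of_real u)) has_integral (g (of_real r) - g (of_real 0))) {0..r}"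
    proof (rule fundamental_theorem_of_calculus)
      fix u assume u: "u \<in> {0..r}"
      have "(g has_field_derivative deriv g (of_real u)) (at (of_real u))"
        by (rule g_deriv) (use u r in auto)
      then show "((\<lambda>u. g (of_real u)) has_vector_derivative deriv g (of_real u)) (at u within {0..r})"
        by (intro has_vector_derivative_real_field)
    qed (use r in auto)
    moreover have "g 0 = a 0" using a[of 0] by (simp add: sums_iff)
    ultimately have "((\<lambda>u. deriv g (of_real u)) has_integral (g (of_real r) - a 0)) {0..r}"
      by simp
    then show "((\<lambda>u. \<Sum>i. f i u) has_integral (g (of_real r) - a 0)) {0..r}"
      by (rule has_integral_eq[rotated]) (simp add: f_suminf)
  qed
  show ?thesis using lim unfolding J_eq I_eq[abs_def] .
qed

section \<open>The estimate\<close>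

definition main_const :: "nat \<Rightarrow> real \<Rightarrow> real" where
  "main_const K \<kappa> = approx_const K \<kappa> + 144 * real K ^ 2 * \<kappa> * kernel_const 1 4 K
    + 12 * real K * kernel_const 0 4 K + kernel_const 0 4 K"

lemma main_const_ge:
  assumes "0 < \<kappa>"
  shows "0 < main_const K \<kappa>" "approx_const K \<kappa> \<le> main_const K \<kappa>"
    "144 * real K ^ 2 * \<kappa> * kernel_const 1 4 K + 12 * real K * kernel_const 0 4 K \<le> main_const K \<kappa>"
    "12 * real K * kernel_const 0 4 K \<le> main_const K \<kappa>"
    "kernel_const 0 4 K \<le> main_const K \<kappa>"
proof -
  have kc: "0 < kernel_const a c K" if "0 \<le> c" for a c by (rule kernel_const_pos[OF that])
  have 1: "0 \<le> approx_const K \<kappa>"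
    unfolding approx_const_def using assms kc[of 2 0] by (intro mult_nonneg_nonneg add_nonneg_nonneg) auto
  have 2: "0 \<le> 144 * real K ^ 2 * \<kappa> * kernel_const 1 4 K"
    using assms kc[of 4 1] by (intro mult_nonneg_nonneg) auto
  have 3: "0 \<le> 12 * real K * kernel_const 0 4 K"
    using kc[of 4 0] by (intro mult_nonneg_nonneg) auto
  have 4: "0 < kernel_const 0 4 K" using kc[of 4 0] by simp
  show "0 < main_const K \<kappa>" "approx_const K \<kappa> \<le> main_const K \<kappa>"
    "144 * real K ^ 2 * \<kappa> * kernel_const 1 4 K + 12 * real K * kernel_const 0 4 K \<le> main_const K \<kappa>"
    "12 * real K * kernel_const 0 4 K \<le> main_const K \<kappa>"
    "kernel_const 0 4 K \<le> main_const K \<kappa>"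
    unfolding main_const_def using 1 2 3 4 by linarith+
qed

text \<open>For each truncation of the expansion of \<open>g\<close> the triangle inequality and the kernel bounds give the right
side, uniformly in the truncation; then the truncation is removed by a limit.\<close>
lemma weighted_mean_estimate:
  fixes d :: "nat \<Rightarrow> real" and a :: "nat \<Rightarrow> complex" and g :: "complex \<Rightarrow> complex"
  assumes d: "bounded_weights (real K) d" and \<theta>: "\<And>k. k \<ge> 1 \<Longrightarrow> \<theta> \<le> d k" "0 < \<theta>" "\<theta> \<le> 1"
    and K: "K \<ge> 1" and n: "n \<ge> 1"
    and g: "g analytic_on ball 0 1" and a: "\<And>z. norm z < 1 \<Longrightarrow> (\<lambda>n. a n * z ^ n) sums g z"
  shows "norm (1 / of_real (p_coeff d n) * (\<Sum>k=0..n. a k * of_real (p_coeff d (n - k)))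
            - g (of_real (rad n)) - S_sum d a n / (of_nat n * of_real (p_coeff d n)))
      \<le> main_const K (2 * (2 * real K) ^ K / \<theta>) * (1 / real n powr \<theta> *
            (\<Sum>j=1..n. norm (S_sum d a j) / p_coeff d j * real j powr (\<theta> - 2))
         + 1 / p_fun d (rad n) *
            (\<Sum>\<^sub>\<infinity>j\<in>{n<..}. norm (S_sum d a j) / real j * exp (- real j / real n)))"
proof -
  define C where "C = main_const K (2 * (2 * real K) ^ K / \<theta>)"
  have \<kappa>0: "0 < 2 * (2 * real K) ^ K / \<theta>" using K \<theta> by simp
  note C = main_const_ge[OF \<kappa>0, of K, folded C_def]
  have pos: "0 < d k" if "k \<ge> 1" for k using \<theta>(1)[OF that] \<theta>(2) by simp
  have pn: "0 < p_coeff d n" by (rule p_coeff_pos) (rule pos)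
  define r where "r = rad n"
  have r: "0 < r" "r < 1" using rad_pos rad_less_one[OF n] by (auto simp: r_def)
  define S where "S = S_sum d a"
  define b where "b = (\<lambda>j. sum_kernel d n j / p_coeff d n)"
  define v where "v = value_kernel d r"
  define e where "e = (\<lambda>j. 1 / real n powr \<theta> * (1 / p_coeff d j * real j powr (\<theta> - 2)))"
  define t where "t = (\<lambda>j. norm (S j) / real j * exp (- real j / real n))"
  define L where "L = 1 / of_real (p_coeff d n) * (\<Sum>k=0..n. a k * of_real (p_coeff d (n - k)))
            - g (of_real r) - S n / (of_nat n * of_real (p_coeff d n))"
  define R where "R = C * ((\<Sum>j=1..n. norm (S j) * e j) + 1 / p_fun d r * (\<Sum>\<^sub>\<infinity>j\<in>{n<..}. t j))"

  have e_nonneg: "0 \<le> e j" for j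
    using p_coeff_weights_nonneg[OF d] by (simp add: e_def)
  have below: "\<bar>b j - v j\<bar> \<le> C * e j" if j: "1 \<le> j" "j < n" for j
  proof (cases "4 * j \<le> n")
    case True
    then show ?thesis
      using kernel_difference_small_index[OF d \<theta> K j(1) True] mult_right_mono[OF C(2) e_nonneg[of j]]
      by (simp add: b_def v_def r_def e_def)
  next
    case False
    then show ?thesis
      using kernel_difference_large_index[OF d \<theta> K j] mult_right_mono[OF C(3) e_nonneg[of j]]
      by (simp add: b_def v_def r_def e_def)
  qed
  have at: "\<bar>v n\<bar> \<le> C * e n"
    using value_kernel_large_index[OF d pos, of \<theta> n n] \<theta> n value_kernel_nonneg[OF d r(2), of n]
      mult_right_mono[OF C(4) e_nonneg[of n]]
    by (simp add: v_def r_def e_def)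
  have above: "norm (S j) * \<bar>v j\<bar> \<le> C * (1 / p_fun d r) * t j" if j: "n < j" for j
  proof -
    have "\<bar>v j\<bar> \<le> kernel_const 0 4 K * (r ^ j / (real j * p_fun d r))"
      using value_kernel_bound[OF d n, of j] value_kernel_nonneg[OF d r(2), of j] j
      by (simp add: v_def r_def)
    also have "\<dots> \<le> C * (r ^ j / (real j * p_fun d r))"
      using C(5) r p_fun_pos[of d r] by (intro mult_right_mono) auto
    finally have "norm (S j) * \<bar>v j\<bar> \<le> norm (S j) * (C * (r ^ j / (real j * p_fun d r)))"
      by (rule mult_left_mono) simp
    then show ?thesis by (simp add: t_def r_def rad_pow mult_ac)
  qed
  have t_summable: "t summable_on {n<..}"
    unfolding t_def S_def
    by (rule S_sum_tail_summable[of d "real K"])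
      (use bounded_weightsD[OF d] a n in \<open>auto simp: sums_iff\<close>)
  have t_nonneg: "0 \<le> t j" for j by (simp add: t_def)

  have L_eq: "L = a 0 + (\<Sum>j=1..n. S j * of_real (b j)) - g (of_real r) - S n * of_real (b n)"
  proof -
    have "b n = 1 / (real n * p_coeff d n)"
      unfolding b_def using sum_kernel_expand[of n n d] n by (simp add: p_coeff_0)
    moreover have "1 / of_real (p_coeff d n) * (\<Sum>k=0..n. a k * of_real (p_coeff d (n - k)))
        = a 0 + (\<Sum>j=1..n. S j * of_real (b j))"
      unfolding weighted_mean_expand using pn
      by (simp add: b_def S_def distrib_left sum_divide_distrib add_divide_distrib)
    ultimately show ?thesis by (simp add: L_def)
  qed
  have bound: "norm (L + (g (of_real r) - a 0 - (\<Sum>i<N. S (Suc i) * of_real (v (Suc i))))) \<le> R" if N: "n \<le> N" for N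
  proof -
    have "(\<Sum>i<N. S (Suc i) * of_real (v (Suc i))) = (\<Sum>j=1..N. S j * of_real (v j))"
      by (rule sum.reindex_bij_witness[of _ "\<lambda>j. j - 1" Suc]) auto
    also have "{1..N} = insert n {1..<n} \<union> {n<..N}" using n N by auto
    also have "(\<Sum>j\<in>\<dots>. S j * of_real (v j))
        = S n * of_real (v n) + (\<Sum>j=1..<n. S j * of_real (v j)) + (\<Sum>j\<in>{n<..N}. S j * of_real (v j))"
      by (subst sum.union_disjoint) auto
    finally have T: "(\<Sum>i<N. S (Suc i) * of_real (v (Suc i)))
        = S n * of_real (v n) + (\<Sum>j=1..<n. S j * of_real (v j)) + (\<Sum>j\<in>{n<..N}. S j * of_real (v j))" .
    have "L + (g (of_real r) - a 0 - (\<Sum>i<N. S (Suc i) * of_real (v (Suc i))))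
        = (\<Sum>j=1..<n. S j * of_real (b j - v j)) - S n * of_real (v n) - (\<Sum>j\<in>{n<..N}. S j * of_real (v j))"
    proof -
      have "{1..n} = insert n {1..<n}" using n by auto
      then have "(\<Sum>j=1..n. S j * of_real (b j)) = S n * of_real (b n) + (\<Sum>j=1..<n. S j * of_real (b j))"
        by simp
      then show ?thesis
        unfolding T by (simp add: L_eq right_diff_distrib sum_subtractf)
    qed
    also have "norm \<dots> \<le> (\<Sum>j=1..<n. norm (S j) * (C * e j)) + norm (S n) * (C * e n)
        + (\<Sum>j\<in>{n<..N}. C * (1 / p_fun d r) * t j)"
    proof (intro order_trans[OF norm_triangle_ineq4] add_mono)
      have "norm (\<Sum>j=1..<n. S j * of_real (b j - v j)) \<le> (\<Sum>j=1..<n. norm (S j * of_real (b j - v j)))"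
        by (rule norm_sum)
      also have "\<dots> \<le> (\<Sum>j=1..<n. norm (S j) * (C * e j))"
      proof (rule sum_mono)
        fix j assume "j \<in> {1..<n}"
        then show "norm (S j * of_real (b j - v j)) \<le> norm (S j) * (C * e j)"
          unfolding norm_mult norm_of_real by (intro mult_left_mono below) auto
      qed
      finally show "norm (\<Sum>j=1..<n. S j * of_real (b j - v j)) \<le> (\<Sum>j=1..<n. norm (S j) * (C * e j))" .
      show "norm (S n * of_real (v n)) \<le> norm (S n) * (C * e n)"
        unfolding norm_mult norm_of_real by (intro mult_left_mono at) auto
      have "norm (\<Sum>j\<in>{n<..N}. S j * of_real (v j)) \<le> (\<Sum>j\<in>{n<..N}. norm (S j * of_real (v j)))"
        by (rule norm_sum)
      also have "\<dots> \<le> (\<Sum>j\<in>{n<..N}. C * (1 / p_fun d r) * t j)"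
        unfolding norm_mult norm_of_real by (intro sum_mono above) auto
      finally show "norm (\<Sum>j\<in>{n<..N}. S j * of_real (v j)) \<le> (\<Sum>j\<in>{n<..N}. C * (1 / p_fun d r) * t j)" .
    qed
    also have "(\<Sum>j=1..<n. norm (S j) * (C * e j)) + norm (S n) * (C * e n) = C * (\<Sum>j=1..n. norm (S j) * e j)"
    proof -
      have "{1..n} = insert n {1..<n}" using n by auto
      then show ?thesis by (simp add: sum_distrib_left mult_ac distrib_left)
    qed
    also have "(\<Sum>j\<in>{n<..N}. C * (1 / p_fun d r) * t j) = C * (1 / p_fun d r) * (\<Sum>j\<in>{n<..N}. t j)"
      by (simp add: sum_distrib_left)
    also have "\<dots> \<le> C * (1 / p_fun d r) * (\<Sum>\<^sub>\<infinity>j\<in>{n<..}. t j)"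
      using C(1) p_fun_pos[of d r] t_nonneg
      by (intro mult_left_mono finite_sum_le_infsum t_summable) auto
    finally show ?thesis by (simp add: R_def distrib_left)
  qed
  have "(\<lambda>N. norm (L + (g (of_real r) - a 0 - (\<Sum>i<N. S (Suc i) * of_real (v (Suc i))))))
      \<longlonglongrightarrow> norm (L + (g (of_real r) - a 0 - (g (of_real r) - a 0)))"
    unfolding S_def v_def by (intro tendsto_intros value_expand[OF d g a r])
  then have "norm (L + (g (of_real r) - a 0 - (g (of_real r) - a 0))) \<le> R"
    by (rule LIMSEQ_le_const2) (use bound in blast)
  then have "norm L \<le> R" by simp
  moreover have "(\<Sum>j=1..n. norm (S j) * e j)
      = 1 / real n powr \<theta> * (\<Sum>j=1..n. norm (S j) / p_coeff d j * real j powr (\<theta> - 2))"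
    by (simp add: e_def sum_distrib_left sum_divide_distrib mult_ac)
  ultimately show ?thesis
    unfolding L_def R_def S_def t_def r_def C_def by simp
qed

text \<open>The natural number \<open>K\<close> rounds up \<open>dp\<close>, so that the upper growth bounds have integer exponents.\<close>
theorem theorem1:
  fixes dm dp :: real
  assumes "0 < dm" and "dm \<le> dp"
  shows "\<exists>c>0. \<forall>(d :: nat \<Rightarrow> real) (a :: nat \<Rightarrow> complex) (g :: complex \<Rightarrow> complex).
    (\<forall>k\<ge>1. dm \<le> d k \<and> d k \<le> dp) \<longrightarrow>
    g analytic_on ball 0 1 \<longrightarrow>
    (\<forall>z\<in>ball 0 1. (\<lambda>n. a n * z ^ n) sums g z) \<longrightarrow>
    (let \<theta> = min dm 1 in
     \<forall>n::nat. n \<ge> 1 \<longrightarrow>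
      norm (1 / of_real (p_coeff d n) * (\<Sum>k=0..n. a k * of_real (p_coeff d (n - k)))
            - g (of_real (exp (- 1 / real n)))
            - S_sum d a n / (of_nat n * of_real (p_coeff d n)))
      \<le> c * (1 / real n powr \<theta> *
                (\<Sum>j=1..n. norm (S_sum d a j) / p_coeff d j * real j powr (\<theta> - 2))
             + 1 / p_fun d (exp (- 1 / real n)) *
                (\<Sum>\<^sub>\<infinity>j\<in>{n<..}. norm (S_sum d a j) / real j * exp (- real j / real n))))"
proof -
  define \<theta> where "\<theta> = min dm 1"
  have \<theta>: "0 < \<theta>" "\<theta> \<le> 1" "\<theta> \<le> dm" using assms by (auto simp: \<theta>_def)
  define K where "K = nat \<lceil>dp\<rceil>"
  have K: "1 \<le> K" "dp \<le> real K" using assms by (auto simp: K_def Suc_le_eq)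
  define c where "c = main_const K (2 * (2 * real K) ^ K / \<theta>)"
  have "0 < c" unfolding c_def using K \<theta> by (intro main_const_ge(1)) simp
  moreover have "norm (1 / of_real (p_coeff d n) * (\<Sum>k=0..n. a k * of_real (p_coeff d (n - k)))
            - g (of_real (exp (- 1 / real n)))
            - S_sum d a n / (of_nat n * of_real (p_coeff d n)))
      \<le> c * (1 / real n powr \<theta> *
                (\<Sum>j=1..n. norm (S_sum d a j) / p_coeff d j * real j powr (\<theta> - 2))
             + 1 / p_fun d (exp (- 1 / real n)) *
                (\<Sum>\<^sub>\<infinity>j\<in>{n<..}. norm (S_sum d a j) / real j * exp (- real j / real n)))"
    if d: "\<forall>k\<ge>1. dm \<le> d k \<and> d k \<le> dp" and g: "g analytic_on ball 0 1"
      and a: "\<forall>z\<in>ball 0 1. (\<lambda>n. a n * z ^ n) sums g z" and n: "n \<ge> 1"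
    for d :: "nat \<Rightarrow> real" and a :: "nat \<Rightarrow> complex" and g :: "complex \<Rightarrow> complex" and n :: nat
    unfolding c_def rad_def[symmetric]
  proof (rule weighted_mean_estimate[OF _ _ \<theta>(1,2) K(1) n g])
    show "bounded_weights (real K) d"
      using d K assms unfolding bounded_weights_def by (meson order_trans less_imp_le)
    show "\<theta> \<le> d k" if "k \<ge> 1" for k using d that \<theta>(3) by (meson order_trans)
    show "(\<lambda>n. a n * z ^ n) sums g z" if "norm z < 1" for z using a that by simp
  qed
  ultimately show ?thesis unfolding Let_def \<theta>_def by blast
qed

end
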